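(* Let $V$ be a finite set with $|V|>1$ and let $(\mathsf Z_i:i\in V)$ be a finite linear source with entropy function $H$. Let $\mathcal P^*$ be the fundamental partition. Then: (a) the MDA algorithm (with CoordSatCapFus as subroutine) outputs $\mathbf r_V\in\mathscr R^*_{\mathrm{ACO}}(V)$ such that $(|\mathcal P^*|-1)\mathbf r_V$ is integral; (b) with input $\alpha=R_{\mathrm{NCO}}(V)$, the CoordSatCapFus algorithm returns $\mathbf r_V\in\mathscr R^*_{\mathrm{NCO}}(V)$; in particular $\mathbf r_V$ is integral.
   Context: Finite linear source: $\mathsf Z_i=A_i\mathsf x$, $i\in V$, with $\mathsf x$ uniform on $\mathbb F_q^l$ and $A_i$ matrices over the finite field $\mathbb F_q$; $H(X)$ (in units of $\log q$) is the rank of the stacked matrix $(A_i)_{i\in X}$, so $H$ is integer-valued; $H(V)=l$; $H(\emptyset)=0$; $H(X|Y)=H(X\cup Y)-H(Y)$. For $\mathbf r_V\in\mathbb R^{|V|}$, $r(X)=\sum_{i\in X}r_i$. $\mathscr R_{\mathrm{CO}}(V)=\{\mathbf r_V: r(X)\ge H(X|V\setminus X)\ \forall X\subsetneq V\}$; $R_{\mathrm{ACO}}(V)=\min\{r(V):\mathbf r_V\in\mathscr R_{\mathrm{CO}}(V)\}$; $R_{\mathrm{NCO}}(V)=\min\{r(V):\mathbf r_V\in\mathscr R_{\mathrm{CO}}(V)\cap\mathbb Z^{|V|}\}$; $\mathscr R^*_{\mathrm{ACO}}(V)=\{\mathbf r_V\in\mathscr R_{\mathrm{CO}}(V): r(V)=R_{\mathrm{ACO}}(V)\}$;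 $\mathscr R^*_{\mathrm{NCO}}(V)=\{\mathbf r_V\in\mathscr R_{\mathrm{CO}}(V)\cap\mathbb Z^{|V|}: r(V)=R_{\mathrm{NCO}}(V)\}$. For a partition $\mathcal P$ of $V$ (into nonempty subsets) with $|\mathcal P|>1$, $\varphi(\mathcal P)=\sum_{C\in\mathcal P}\frac{H(V)-H(C)}{|\mathcal P|-1}$. One has $R_{\mathrm{ACO}}(V)=\max_{|\mathcal P|>1}\varphi(\mathcal P)$, and the unique finest maximizer is the fundamental partition. For $\alpha\ge0$: $f^{\#}_\alpha(\emptyset)=0$, $f^{\#}_\alpha(X)=\alpha-H(V)+H(X)$ for $X\neq\emptyset$. $\chi_i$ is the $i$-th unit vector, $\chi_V$ the all-ones vector; for a family $U$ of disjoint sets, $\tilde U=\bigsqcup_{X\in U}X$. CoordSatCapFus (input $\alpha$): choose any linear ordering $(\phi_1,\dots,\phi_{|V|})$ of $V$; set $\mathbf r_V=(\alpha-H(V))\chi_V$, then $r_{\phi_1}\leftarrow f^{\#}_\alpha(\{\phi_1\})$, $\mathcal P^*_1=\{\{\phi_1\}\}$. For $i=2,\dots,|V|$: $\mathcal P^*_i\leftarrow\mathcal P^*_{i-1}\sqcup\{\{\phi_i\}\}$; let $\hat\xi_{\phi_i}$ and $U^*_{\phi_i}$ be the minimum and the inclusion-minimal minimizer of $\min\{f^{\#}_\alpha(\tilde U)-r(\tilde U):\{\phi_i\}\in U\subseteq\mathcal P^*_i\}$; set $\mathbf r_V\leftarrow\mathbf r_V+\hat\xi_{\phi_i}\chi_{\phi_i}$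 and $\mathcal P^*_i\leftarrow(\mathcal P^*_i\setminus U^*_{\phi_i})\sqcup\{\tilde U^*_{\phi_i}\}$. Return $\mathbf r_V$ and $\mathcal P^*_{|V|}$. MDA: set $\alpha\leftarrow\max\{\max_{i\in V}\varphi(\{\{i\},V\setminus\{i\}\}),\varphi(\{\{m\}:m\in V\})\}$; run CoordSatCapFus with input $\alpha$ to get $\mathbf r_V$ and the partition $\mathcal P^*=\mathcal P^*_{|V|}$; $\hat\alpha\leftarrow\varphi(\mathcal P^* )$; while $\hat\alpha\ne\alpha$: $\alpha\leftarrow\hat\alpha$, run CoordSatCapFus with input $\alpha$ to get $\mathbf r_V,\mathcal P^*$, $\hat\alpha\leftarrow\varphi(\mathcal P^* )$. Return $\alpha,\mathcal P^*,\mathbf r_V$. (The returned $\mathcal P^*$ is the fundamental partition.) *)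

theory Defs
  imports
    "HOL-Probability.Information"
    "HOL-Library.Disjoint_Sets"
    "HOL-Library.While_Combinator"
    "Jordan_Normal_Form.DL_Rank"
begin

section \<open>Finite linear sources\<close>

text \<open>
  The joint random variable formed by the components \<open>Z\<^sub>i = A\<^sub>i x\<close> with \<open>i \<in> X\<close>, and its Shannon
  entropy for \<open>x\<close> uniform on \<open>F\<^sub>q\<^sup>l\<close>.  The logarithm has base \<open>q\<close>, the cardinality of the field.
  Lemma \<open>source_entropy_eq_rank\<close> below identifies this entropy with the rank of the stacked matrix.
\<close>

definition source_rv ::
    "('v \<Rightarrow> 'q::{finite,field} mat) \<Rightarrow> 'v set \<Rightarrow> 'q Matrix.vec \<Rightarrow> 'v \<Rightarrow> 'q Matrix.vec" where
  "source_rv A X x = restrict (\<lambda>i. A i *\<^sub>v x) X"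

definition source_entropy ::
    "nat \<Rightarrow> ('v \<Rightarrow> 'q::{finite,field} mat) \<Rightarrow> 'v set \<Rightarrow> real" where
  "source_entropy l A X =
     prob_space.entropy (uniform_count_measure (carrier_vec l)) (real CARD('q))
       (count_space (source_rv A X ` carrier_vec l)) (source_rv A X)"

definition finite_linear_source ::
    "'v set \<Rightarrow> nat \<Rightarrow> ('v \<Rightarrow> 'q::{finite,field} mat) \<Rightarrow> bool" where
  "finite_linear_source V l A \<longleftrightarrow>
     finite V \<and> (\<forall>i\<in>V. dim_col (A i) = l) \<and> source_entropy l A V = real l"

section \<open>Communication for omniscience\<close>

text \<open>
  Below, \<open>V\<close> is the finite ground set and \<open>H\<close> the entropy function.  A rate vector is a function
  \<open>r :: 'v \<Rightarrow> real\<close>, of which only the restriction to \<open>V\<close> matters.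
\<close>

definition cond_entropy :: "('v set \<Rightarrow> real) \<Rightarrow> 'v set \<Rightarrow> 'v set \<Rightarrow> real" where
  "cond_entropy H X Y = H (X \<union> Y) - H Y"

definition R_CO :: "'v set \<Rightarrow> ('v set \<Rightarrow> real) \<Rightarrow> ('v \<Rightarrow> real) set" where
  "R_CO V H = {r. \<forall>X. X \<subset> V \<longrightarrow> sum r X \<ge> cond_entropy H X (V - X)}"

definition integral_on :: "'v set \<Rightarrow> ('v \<Rightarrow> real) \<Rightarrow> bool" where
  "integral_on V r \<longleftrightarrow> (\<forall>i\<in>V. r i \<in> \<int>)"

text \<open>The minima are rendered by \<open>LEAST\<close>, so that attainment is not presupposed.\<close>

definition R_ACO :: "'v set \<Rightarrow> ('v set \<Rightarrow> real) \<Rightarrow> real" where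
  "R_ACO V H = (LEAST s. s \<in> (\<lambda>r. sum r V) ` R_CO V H)"

definition R_NCO :: "'v set \<Rightarrow> ('v set \<Rightarrow> real) \<Rightarrow> real" where
  "R_NCO V H = (LEAST s. s \<in> (\<lambda>r. sum r V) ` {r \<in> R_CO V H. integral_on V r})"

definition R_ACO_opt :: "'v set \<Rightarrow> ('v set \<Rightarrow> real) \<Rightarrow> ('v \<Rightarrow> real) set" where
  "R_ACO_opt V H = {r \<in> R_CO V H. sum r V = R_ACO V H}"

definition R_NCO_opt :: "'v set \<Rightarrow> ('v set \<Rightarrow> real) \<Rightarrow> ('v \<Rightarrow> real) set" where
  "R_NCO_opt V H = {r \<in> R_CO V H. integral_on V r \<and> sum r V = R_NCO V H}"

section \<open>The fundamental partition\<close>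

text \<open>\<open>\<phi>(P)\<close>; for \<open>card P = 1\<close>, which the definition does not cover, the value is \<open>0\<close>.\<close>

definition partition_rate :: "'v set \<Rightarrow> ('v set \<Rightarrow> real) \<Rightarrow> 'v set set \<Rightarrow> real" where
  "partition_rate V H P = (\<Sum>C\<in>P. (H V - H C) / (real (card P) - 1))"

definition rate_maximizer :: "'v set \<Rightarrow> ('v set \<Rightarrow> real) \<Rightarrow> 'v set set \<Rightarrow> bool" where
  "rate_maximizer V H =
     is_arg_max (partition_rate V H) (\<lambda>P. partition_on V P \<and> card P > 1)"

definition fundamental_partition :: "'v set \<Rightarrow> ('v set \<Rightarrow> real) \<Rightarrow> 'v set set" where
  "fundamental_partition V H =
     (THE P. rate_maximizer V H P \<and> (\<forall>Q. rate_maximizer V H Q \<longrightarrow> refines V P Q))"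

section \<open>The algorithm CoordSatCapFus\<close>

definition f_sharp :: "'v set \<Rightarrow> ('v set \<Rightarrow> real) \<Rightarrow> real \<Rightarrow> 'v set \<Rightarrow> real" where
  "f_sharp V H \<alpha> X = (if X = {} then 0 else \<alpha> - H V + H X)"

definition slack ::
    "'v set \<Rightarrow> ('v set \<Rightarrow> real) \<Rightarrow> real \<Rightarrow> ('v \<Rightarrow> real) \<Rightarrow> 'v set set \<Rightarrow> real" where
  "slack V H \<alpha> r U = f_sharp V H \<alpha> (\<Union>U) - sum r (\<Union>U)"

definition fusion_cands :: "'v \<Rightarrow> 'v set set \<Rightarrow> 'v set set set" where
  "fusion_cands v P = {U. {v} \<in> U \<and> U \<subseteq> P}"

definition sat_cap ::
    "'v set \<Rightarrow> ('v set \<Rightarrow> real) \<Rightarrow> real \<Rightarrow> ('v \<Rightarrow> real) \<Rightarrow> 'v \<Rightarrow> 'v set set \<Rightarrow> real" where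
  "sat_cap V H \<alpha> r v P = Min (slack V H \<alpha> r ` fusion_cands v P)"

text \<open>The inclusion-minimal element among the minimizers attaining \<^const>\<open>sat_cap\<close>.\<close>

definition fusion_set ::
    "'v set \<Rightarrow> ('v set \<Rightarrow> real) \<Rightarrow> real \<Rightarrow> ('v \<Rightarrow> real) \<Rightarrow> 'v \<Rightarrow> 'v set set \<Rightarrow> 'v set set" where
  "fusion_set V H \<alpha> r v P =
     (let minimizers = {U \<in> fusion_cands v P. slack V H \<alpha> r U = sat_cap V H \<alpha> r v P}
      in THE U. U \<in> minimizers \<and> (\<forall>W\<in>minimizers. \<not> W \<subset> U))"

definition fusion_step ::
    "'v set \<Rightarrow> ('v set \<Rightarrow> real) \<Rightarrow> real \<Rightarrow> 'v \<Rightarrow>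
     ('v \<Rightarrow> real) \<times> 'v set set \<Rightarrow> ('v \<Rightarrow> real) \<times> 'v set set" where
  "fusion_step V H \<alpha> v = (\<lambda>(r, P).
     let P' = insert {v} P;
         \<xi> = sat_cap V H \<alpha> r v P';
         U = fusion_set V H \<alpha> r v P'
     in (r(v := r v + \<xi>), insert (\<Union>U) (P' - U)))"

text \<open>The linear ordering of \<open>V\<close> is given by the list \<open>vs\<close>, which is processed from left to right.\<close>

definition linear_ordering :: "'v set \<Rightarrow> 'v list \<Rightarrow> bool" where
  "linear_ordering V vs \<longleftrightarrow> distinct vs \<and> set vs = V"

definition coord_sat_cap_fus ::
    "'v set \<Rightarrow> ('v set \<Rightarrow> real) \<Rightarrow> real \<Rightarrow> 'v list \<Rightarrow> ('v \<Rightarrow> real) \<times> 'v set set" where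
  "coord_sat_cap_fus V H \<alpha> vs =
     (let r = (\<lambda>i. (\<alpha> - H V) * indicator V i)
      in fold (fusion_step V H \<alpha>) (tl vs)
           (r(hd vs := f_sharp V H \<alpha> {hd vs}), {{hd vs}}))"

section \<open>The modified decomposition algorithm\<close>

definition mda_init :: "'v set \<Rightarrow> ('v set \<Rightarrow> real) \<Rightarrow> real" where
  "mda_init V H =
     max (Max ((\<lambda>i. partition_rate V H {{i}, V - {i}}) ` V))
         (partition_rate V H ((\<lambda>m. {m}) ` V))"

text \<open>
  Every call of CoordSatCapFus may choose its own linear ordering; the \<open>k\<close>-th call uses \<open>ords k\<close>.
  The loop state is \<open>(k, \<alpha>, r, P)\<close>, with \<open>\<alpha>\<close> the input and \<open>(r, P)\<close> the output of the \<open>k\<close>-th call,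
  and \<open>partition_rate V H P\<close> is the next estimate compared with \<open>\<alpha>\<close>.
  The result is \<open>None\<close> iff the loop does not terminate.
\<close>

definition mda ::
    "'v set \<Rightarrow> ('v set \<Rightarrow> real) \<Rightarrow> (nat \<Rightarrow> 'v list) \<Rightarrow>
     (real \<times> 'v set set \<times> ('v \<Rightarrow> real)) option" where
  "mda V H ords =
     map_option (\<lambda>(k, \<alpha>, r, P). (\<alpha>, P, r))
       (while_option
          (\<lambda>(k, \<alpha>, r, P). partition_rate V H P \<noteq> \<alpha>)
          (\<lambda>(k, \<alpha>, r, P).
             let \<alpha>' = partition_rate V H P;
                 (r', P') = coord_sat_cap_fus V H \<alpha>' (ords (Suc k))
             in (Suc k, \<alpha>', r', P'))
          (let \<alpha> = mda_init V H;
               (r, P) = coord_sat_cap_fus V H \<alpha> (ords 0)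
           in (0 :: nat, \<alpha>, r, P)))"

section \<open>Entropy as the rank of the stacked matrix\<close>

definition stacked_mat :: "nat \<Rightarrow> ('v \<Rightarrow> 'q mat) \<Rightarrow> 'v list \<Rightarrow> 'q mat" where
  "stacked_mat l A xs = mat_of_rows l (concat (map (\<lambda>i. Matrix.rows (A i)) xs))"

lemma finite_carrier_vec_finite: "finite (carrier_vec l :: 'q::finite Matrix.vec set)"
proof -
  have "carrier_vec l \<subseteq> (\<lambda>xs::'q list. vec_of_list xs) ` {xs. set xs \<subseteq> UNIV \<and> length xs = l}"
  proof
    fix v :: "'q Matrix.vec" assume "v \<in> carrier_vec l"
    then have "v = vec_of_list (list_of_vec v)" "length (list_of_vec v) = l"
      by (auto simp: vec_list)
    then show "v \<in> (\<lambda>xs::'q list. vec_of_list xs) ` {xs. set xs \<subseteq> UNIV \<and> length xs = l}"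
      by auto
  qed
  moreover have "finite {xs :: 'q list. set xs \<subseteq> UNIV \<and> length xs = l}"
    by (rule finite_lists_length_eq) simp
  ultimately show ?thesis by (meson finite_imageI finite_subset)
qed

lemma card_image_eq_if_same_kernel:
  assumes "\<And>x y. x \<in> K \<Longrightarrow> y \<in> K \<Longrightarrow> f x = f y \<longleftrightarrow> g x = g y"
  shows "card (f ` K) = card (g ` K)"
proof (rule bij_betw_same_card)
  show "bij_betw (\<lambda>b. g (SOME x. x \<in> K \<and> f x = b)) (f ` K) (g ` K)"
  proof (rule bij_betw_imageI)
    have *: "(SOME x. x \<in> K \<and> f x = f a) \<in> K \<and> f (SOME x. x \<in> K \<and> f x = f a) = f a"
      if "a \<in> K" for a using someI[of "\<lambda>x. x \<in> K \<and> f x = f a" a] that by blast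
    then have **: "g (SOME x. x \<in> K \<and> f x = f a) = g a" if "a \<in> K" for a
      using assms that by blast
    show "inj_on (\<lambda>b. g (SOME x. x \<in> K \<and> f x = b)) (f ` K)"
      using ** assms by (auto simp: inj_on_def)
    show "(\<lambda>b. g (SOME x. x \<in> K \<and> f x = b)) ` f ` K = g ` K"
      using ** by (force simp: image_iff)
  qed
qed

lemma entropy_uniform_fibers:
  fixes K :: "'a set" and Z :: "'a \<Rightarrow> 'b" and b :: real
  assumes fin: "finite K" and ne: "K \<noteq> {}" and b: "1 < b"
    and fib: "\<And>y. y \<in> Z ` K \<Longrightarrow> card {x\<in>K. Z x = y} = c"
  shows "prob_space.entropy (uniform_count_measure K) b (count_space (Z ` K)) Z
           = log b (card (Z ` K))"
proof -
  let ?M = "uniform_count_measure K"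
  interpret prob_space ?M by (rule prob_space_uniform_count_measure[OF fin ne])
  interpret information_space ?M b by standard (rule b)
  have cK: "card K = card (Z ` K) * c"
  proof -
    have "card K = (\<Sum>y\<in>Z ` K. card {x\<in>K. Z x = y})"
      using sum.image_gen[OF fin, of "\<lambda>_. 1::nat" Z] by simp
    then show ?thesis using fib by simp
  qed
  have pos: "0 < card K" "0 < card (Z ` K)" using fin ne by (auto simp: card_gt_0_iff)
  let ?f = "\<lambda>_::'b. 1 / real (card (Z ` K))"
  have "simple_distributed ?M Z ?f"
  proof (rule simple_distributedI)
    show "simple_function ?M Z"
      using fin by (auto simp: simple_function_def space_uniform_count_measure sets_uniform_count_measure)
    show "?f y = measure ?M (Z -` {y} \<inter> space ?M)" if "y \<in> Z ` space ?M" for y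
    proof -
      have "Z -` {y} \<inter> space ?M = {x\<in>K. Z x = y}"
        by (auto simp: space_uniform_count_measure)
      then show ?thesis
        using fib[of y] that cK pos fin
        by (simp add: measure_uniform_count_measure space_uniform_count_measure)
    qed
  qed auto
  from entropy_simple_distributed[OF this] show ?thesis
    using pos by (simp add: space_uniform_count_measure log_divide)
qed

lemma (in vectorspace) card_carrier_fin_dim:
  assumes "fin_dim"
  shows "card (carrier V) = card (carrier K) ^ dim"
proof -
  obtain B where B: "finite B" "basis B" using finite_basis_exists[OF assms] by blast
  then have BC: "B \<subseteq> carrier V" by (simp add: basis_def)
  have crit: "\<exists>! a. a \<in> B \<rightarrow>\<^sub>E carrier K \<and> lincomb a B = v" if "v \<in> carrier V" for v
    using basis_criterion[OF B(1) BC] B(2) that by blast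
  have closed: "lincomb a B \<in> carrier V" if "a \<in> B \<rightarrow>\<^sub>E carrier K" for a
    using that BC by (intro lincomb_closed) (auto simp: PiE_def)
  have "bij_betw (\<lambda>a. lincomb a B) (B \<rightarrow>\<^sub>E carrier K) (carrier V)"
  proof (rule bij_betw_imageI)
    show "inj_on (\<lambda>a. lincomb a B) (B \<rightarrow>\<^sub>E carrier K)"
      using crit closed unfolding inj_on_def by metis
    show "(\<lambda>a. lincomb a B) ` (B \<rightarrow>\<^sub>E carrier K) = carrier V"
    proof
      show "(\<lambda>a. lincomb a B) ` (B \<rightarrow>\<^sub>E carrier K) \<subseteq> carrier V" using closed by blast
      show "carrier V \<subseteq> (\<lambda>a. lincomb a B) ` (B \<rightarrow>\<^sub>E carrier K)"
        using crit by (smt (verit) image_iff subsetI)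
    qed
  qed
  then have "card (carrier V) = card (B \<rightarrow>\<^sub>E carrier K)"
    by (metis bij_betw_same_card)
  then show ?thesis using B by (simp add: card_PiE dim_basis)
qed

lemma card_image_mat_eq_rank:
  fixes M :: "'q::{finite,field} mat"
  assumes M: "M \<in> carrier_mat n l"
  shows "card ((\<lambda>x. M *\<^sub>v x) ` carrier_vec l) = CARD('q) ^ vec_space.rank n M"
proof -
  interpret vec_space "TYPE('q)" n .
  have sub: "set (cols M) \<subseteq> carrier_vec n" using M cols_dim by blast
  interpret W: vectorspace class_ring "span_vs (set (cols M))"
    by (rule subspace_is_vs[OF span_is_subspace]) (simp add: sub)
  have fd: "W.fin_dim" using fin_dim_span_cols[OF M] .
  have "(\<lambda>x. M *\<^sub>v x) ` carrier_vec l = span (set (cols M))"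
    using col_space_eq[OF M] M unfolding col_space_def by auto
  then show ?thesis
    using W.card_carrier_fin_dim[OF fd] by (simp add: rank_def)
qed

lemma source_rv_eq_iff_stacked:
  fixes A :: "'v \<Rightarrow> 'q::{finite,field} mat"
  assumes dims: "\<And>i. i \<in> set xs \<Longrightarrow> dim_col (A i) = l"
    and x: "x \<in> carrier_vec l" and y: "y \<in> carrier_vec l"
  shows "source_rv A (set xs) x = source_rv A (set xs) y
           \<longleftrightarrow> stacked_mat l A xs *\<^sub>v x = stacked_mat l A xs *\<^sub>v y"
proof -
  let ?rs = "concat (map (\<lambda>i. Matrix.rows (A i)) xs)"
  have "source_rv A (set xs) x = source_rv A (set xs) y
          \<longleftrightarrow> (\<forall>i\<in>set xs. A i *\<^sub>v x = A i *\<^sub>v y)"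
    by (auto simp: source_rv_def restrict_def fun_eq_iff)
  also have "\<dots> \<longleftrightarrow> (\<forall>i\<in>set xs. \<forall>w\<in>set (Matrix.rows (A i)). scalar_prod w x = scalar_prod w y)"
    by (auto simp: Matrix.rows_def vec_eq_iff)
  also have "\<dots> \<longleftrightarrow> (\<forall>w\<in>set ?rs. scalar_prod w x = scalar_prod w y)" by auto
  also have "\<dots> \<longleftrightarrow> (\<forall>k<length ?rs. scalar_prod (?rs ! k) x = scalar_prod (?rs ! k) y)"
    by (metis in_set_conv_nth)
  also have "\<dots> \<longleftrightarrow> stacked_mat l A xs *\<^sub>v x = stacked_mat l A xs *\<^sub>v y"
  proof -
    have rsc: "set ?rs \<subseteq> carrier_vec l"
      using dims by (fastforce simp: Matrix.rows_def)
    have "row (mat_of_rows l ?rs) k = ?rs ! k" if "k < length ?rs" for k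
      using that rsc nth_mem[OF that] by (intro mat_of_rows_row) auto
    then show ?thesis
      unfolding stacked_mat_def by (auto simp: vec_eq_iff)
  qed
  finally show ?thesis .
qed

lemma card_mat_fiber:
  fixes M :: "'q::{finite,field} mat"
  assumes M: "M \<in> carrier_mat n l" and u: "u \<in> carrier_vec l"
  shows "card {x \<in> carrier_vec l. M *\<^sub>v x = M *\<^sub>v u} = card {x \<in> carrier_vec l. M *\<^sub>v x = 0\<^sub>v n}"
proof -
  let ?F = "{x \<in> carrier_vec l. M *\<^sub>v x = M *\<^sub>v u}" and ?N = "{x \<in> carrier_vec l. M *\<^sub>v x = 0\<^sub>v n}"
  have Mu: "M *\<^sub>v u \<in> carrier_vec n" using M u by simp
  have "bij_betw (\<lambda>x. x + u) ?N ?F"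
  proof (rule bij_betw_byWitness[where f' = "\<lambda>x. x - u"])
    show "\<forall>a\<in>?N. a + u - u = a" using u by (auto simp: vec_eq_iff)
    show "\<forall>a\<in>?F. a - u + u = a" using u by (auto simp: vec_eq_iff)
    show "(\<lambda>x. x + u) ` ?N \<subseteq> ?F"
      using Mu u by (auto simp: mult_add_distrib_mat_vec[OF M])
    show "(\<lambda>x. x - u) ` ?F \<subseteq> ?N"
      using Mu u by (auto simp: mult_minus_distrib_mat_vec[OF M])
  qed
  then show ?thesis by (metis (lifting) bij_betw_same_card)
qed

theorem source_entropy_eq_rank:
  fixes A :: "'v \<Rightarrow> 'q::{finite,field} mat"
  assumes dims: "\<And>i. i \<in> set xs \<Longrightarrow> dim_col (A i) = l"
  shows "source_entropy l A (set xs)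
           = real (vec_space.rank (dim_row (stacked_mat l A xs)) (stacked_mat l A xs))"
proof -
  define M where "M = stacked_mat l A xs"
  define n where "n = dim_row M"
  let ?K = "carrier_vec l :: 'q Matrix.vec set" and ?Z = "source_rv A (set xs)"
  have M: "M \<in> carrier_mat n l"
    unfolding n_def M_def stacked_mat_def by (intro carrier_matI) simp_all
  have ker: "?Z x = ?Z y \<longleftrightarrow> M *\<^sub>v x = M *\<^sub>v y" if "x \<in> ?K" "y \<in> ?K" for x y
    unfolding M_def using dims that by (rule source_rv_eq_iff_stacked)
  have ne: "?K \<noteq> {}" using zero_carrier_vec by blast
  have "card {0, 1::'q} \<le> CARD('q)" by (rule card_mono) simp_all
  then have q: "1 < real CARD('q)" by simp
  have fib: "card {x\<in>?K. ?Z x = b} = card {x\<in>?K. M *\<^sub>v x = 0\<^sub>v n}" if "b \<in> ?Z ` ?K" for b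
  proof -
    from that obtain u where u: "u \<in> ?K" and b: "b = ?Z u" by blast
    have "{x\<in>?K. ?Z x = b} = {x\<in>?K. M *\<^sub>v x = M *\<^sub>v u}" unfolding b using ker u by blast
    then show ?thesis by (simp only: card_mat_fiber[OF M u])
  qed
  have "source_entropy l A (set xs) = log (real CARD('q)) (card (?Z ` ?K))"
    unfolding source_entropy_def
    by (rule entropy_uniform_fibers[OF finite_carrier_vec_finite ne q fib])
  also have "card (?Z ` ?K) = card ((\<lambda>x. M *\<^sub>v x) ` ?K)"
    by (rule card_image_eq_if_same_kernel) (rule ker)
  also have "\<dots> = CARD('q) ^ vec_space.rank n M"
    by (rule card_image_mat_eq_rank[OF M])
  finally show ?thesis using q by (simp add: log_nat_power n_def M_def)
qed

end

theory Submission
  imports Defs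
begin

text \<open>
  CoordSatCapFus raises one coordinate at a time to its saturation capacity, so its output \<open>r\<close> lies
  below \<open>f\<^sup>#\<close> and saturates every block of \<open>P\<close>.  As saturated sets that intersect have a saturated
  union and intersection, \<open>P\<close> is the finest partition into saturated sets, and \<open>r(V)\<close> is the minimum
  of \<open>\<Sum>\<^sub>C f\<^sup>#(C)\<close> over all partitions.  This minimum equals \<open>\<alpha>\<close> if and only if \<open>\<alpha>\<close> is at least the
  maximum of \<open>\<phi>\<close>, and then \<open>r(V) = \<alpha>\<close> turns \<open>r \<le> f\<^sup>#\<close> into the constraints of omniscience.  Below the
  maximum of \<open>\<phi>\<close> one has \<open>\<phi>(P) > \<alpha>\<close>, so the iteration increases \<open>\<alpha>\<close> strictly until the maximum is
  reached; there \<open>P\<close> is the fundamental partition.  Every new coordinate is a difference of a value of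
  \<open>f\<^sup>#\<close> and older coordinates, so a factor that makes \<open>f\<^sup>#\<close> integral makes \<open>r\<close> integral.
\<close>

section \<open>Counting points of common kernels over a finite field\<close>

section \<open>Submodularity of the entropy\<close>

text \<open>The null space of the stacked matrix, described without choosing an order on
  \<open>X\<close>.\<close>

definition source_kernel :: "nat \<Rightarrow> ('v \<Rightarrow> 'q::{finite,field} mat) \<Rightarrow> 'v set \<Rightarrow> 'q Matrix.vec set" where
  "source_kernel l A X = {x \<in> carrier_vec l. \<forall>i\<in>X. A i *\<^sub>v x = 0\<^sub>v (dim_row (A i))}"

lemma finite_source_kernel: "finite (source_kernel l A X)"
  unfolding source_kernel_def using finite_carrier_vec_finite by (rule rev_finite_subset) blast

lemma zero_mem_source_kernel:
  assumes "\<And>i. i \<in> X \<Longrightarrow> dim_col (A i) = l"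
  shows "0\<^sub>v l \<in> source_kernel l A X"
proof -
  have "A i *\<^sub>v 0\<^sub>v l = 0\<^sub>v (dim_row (A i))" if "i \<in> X" for i
    using assms[OF that] by (intro eq_vecI) (simp_all add: scalar_prod_def)
  then show ?thesis by (simp add: source_kernel_def)
qed

lemma card_source_kernel_pos:
  assumes "\<And>i. i \<in> X \<Longrightarrow> dim_col (A i) = l"
  shows "0 < card (source_kernel l A X)"
  using zero_mem_source_kernel[of X A l] assms finite_source_kernel card_gt_0_iff by blast

lemma minus_mem_source_kernel:
  assumes "\<And>i. i \<in> X \<Longrightarrow> dim_col (A i) = l"
    and "x \<in> source_kernel l A X" "y \<in> source_kernel l A X"
  shows "x - y \<in> source_kernel l A X"
proof -
  have "A i *\<^sub>v (x - y) = 0\<^sub>v (dim_row (A i))" if "i \<in> X" for i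
  proof -
    have "A i \<in> carrier_mat (dim_row (A i)) l" using assms(1)[OF that] by auto
    from mult_minus_distrib_mat_vec[OF this, of x y] show ?thesis
      using assms that by (auto simp: source_kernel_def)
  qed
  then show ?thesis using assms by (auto simp: source_kernel_def)
qed

text \<open>Translation by \<open>u\<close> carries the kernel onto the fiber through
  \<open>u\<close>, so the joint variable is uniform on its image.\<close>

lemma card_fiber_source_rv:
  assumes dims: "\<And>i. i \<in> X \<Longrightarrow> dim_col (A i) = l" and u: "u \<in> carrier_vec l"
  shows "card {x \<in> carrier_vec l. source_rv A X x = source_rv A X u} = card (source_kernel l A X)"
proof -
  have eq: "{x \<in> carrier_vec l. source_rv A X x = source_rv A X u}
      = {x \<in> carrier_vec l. \<forall>i\<in>X. A i *\<^sub>v x = A i *\<^sub>v u}"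
    by (auto simp: source_rv_def restrict_def fun_eq_iff)
  have M: "A i \<in> carrier_mat (dim_row (A i)) l" if "i \<in> X" for i
    using dims[OF that] by auto
  have "bij_betw (\<lambda>x. x + u) (source_kernel l A X)
      {x \<in> carrier_vec l. \<forall>i\<in>X. A i *\<^sub>v x = A i *\<^sub>v u}"
  proof (rule bij_betw_byWitness[where f' = "\<lambda>x. x - u"])
    show "\<forall>a\<in>source_kernel l A X. a + u - u = a"
      using u by (auto simp: source_kernel_def vec_eq_iff)
    show "\<forall>a\<in>{x \<in> carrier_vec l. \<forall>i\<in>X. A i *\<^sub>v x = A i *\<^sub>v u}. a - u + u = a"
      using u by (auto simp: vec_eq_iff)
    show "(\<lambda>x. x + u) ` source_kernel l A X \<subseteq> {x \<in> carrier_vec l. \<forall>i\<in>X. A i *\<^sub>v x = A i *\<^sub>v u}"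
    proof clarsimp
      fix a assume a: "a \<in> source_kernel l A X"
      then have ac: "a \<in> carrier_vec l" by (simp add: source_kernel_def)
      have "A i *\<^sub>v (a + u) = A i *\<^sub>v u" if "i \<in> X" for i
        using mult_add_distrib_mat_vec[OF M[OF that] ac u] a that
          mult_mat_vec_carrier[OF M[OF that] u] by (auto simp: source_kernel_def)
      then show "a + u \<in> carrier_vec l \<and> (\<forall>i\<in>X. A i *\<^sub>v (a + u) = A i *\<^sub>v u)"
        using ac u by simp
    qed
    show "(\<lambda>x. x - u) ` {x \<in> carrier_vec l. \<forall>i\<in>X. A i *\<^sub>v x = A i *\<^sub>v u} \<subseteq> source_kernel l A X"
    proof clarsimp
      fix a assume a: "a \<in> carrier_vec l" "\<forall>i\<in>X. A i *\<^sub>v a = A i *\<^sub>v u"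
      have "A i *\<^sub>v (a - u) = 0\<^sub>v (dim_row (A i))" if "i \<in> X" for i
        using mult_minus_distrib_mat_vec[OF M[OF that] a(1) u] a(2) that
          mult_mat_vec_carrier[OF M[OF that] u] by auto
      then show "a - u \<in> source_kernel l A X" using a u by (simp add: source_kernel_def)
    qed
  qed
  then show ?thesis unfolding eq by (rule bij_betw_same_card[symmetric])
qed

lemma one_less_card_field: "1 < real CARD('q::{finite,field})"
proof -
  have "card {0, 1::'q} \<le> CARD('q)" by (rule card_mono) simp_all
  then show ?thesis by simp
qed

text \<open>Rank-nullity in counting form. It reduces submodularity of the entropy to a product
  inequality between kernel sizes.\<close>

lemma source_entropy_eq_log_kernel:
  fixes A :: "'v \<Rightarrow> 'q::{finite,field} mat"
  assumes dims: "\<And>i. i \<in> X \<Longrightarrow> dim_col (A i) = l"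
  shows "source_entropy l A X = log (real CARD('q)) (card (carrier_vec l :: 'q Matrix.vec set))
    - log (real CARD('q)) (card (source_kernel l A X))"
proof -
  let ?K = "carrier_vec l :: 'q Matrix.vec set" and ?Z = "source_rv A X"
  have ne: "?K \<noteq> {}" using zero_carrier_vec by blast
  have fib: "card {x\<in>?K. ?Z x = y} = card (source_kernel l A X)" if "y \<in> ?Z ` ?K" for y
  proof -
    from that obtain u where u: "u \<in> ?K" and y: "y = ?Z u" by blast
    show ?thesis unfolding y using dims u by (rule card_fiber_source_rv)
  qed
  have "card ?K = (\<Sum>y\<in>?Z ` ?K. card {x\<in>?K. ?Z x = y})"
    using sum.image_gen[OF finite_carrier_vec_finite, of "\<lambda>_. 1::nat" l ?Z] by simp
  then have cK: "card ?K = card (?Z ` ?K) * card (source_kernel l A X)" using fib by simp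
  have "0 < card ?K" using ne finite_carrier_vec_finite card_gt_0_iff by blast
  then have pos: "0 < real (card (?Z ` ?K))" "0 < real (card (source_kernel l A X))"
    using cK by (auto intro: Nat.gr0I)
  have "source_entropy l A X = log (real CARD('q)) (card (?Z ` ?K))"
    unfolding source_entropy_def
    by (rule entropy_uniform_fibers[OF finite_carrier_vec_finite ne one_less_card_field fib])
  then show ?thesis using cK pos by (simp add: log_mult)
qed

text \<open>Addition maps \<open>N\<^sub>X \<times> N\<^sub>Y\<close> into \<open>N\<^sub>X\<^sub>\<inter>\<^sub>Y\<close>, and a fiber of it is determined by an element of
  \<open>N\<^sub>X \<inter> N\<^sub>Y = N\<^sub>X\<^sub>\<union>\<^sub>Y\<close>.\<close>

lemma card_source_kernel_supermodular:
  fixes A :: "'v \<Rightarrow> 'q::{finite,field} mat"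
  assumes dims: "\<And>i. i \<in> X \<union> Y \<Longrightarrow> dim_col (A i) = l"
  shows "card (source_kernel l A X) * card (source_kernel l A Y)
    \<le> card (source_kernel l A (X \<union> Y)) * card (source_kernel l A (X \<inter> Y))"
proof -
  let ?N = "source_kernel l A"
  let ?s = "\<lambda>p::'q Matrix.vec \<times> 'q Matrix.vec. fst p - snd p"
  have sub: "?s ` (?N X \<times> ?N Y) \<subseteq> ?N (X \<inter> Y)"
  proof clarsimp
    fix a b assume "a \<in> ?N X" "b \<in> ?N Y"
    then have "a \<in> ?N (X \<inter> Y)" "b \<in> ?N (X \<inter> Y)" by (auto simp: source_kernel_def)
    then show "a - b \<in> ?N (X \<inter> Y)" using minus_mem_source_kernel[of "X \<inter> Y" A l] dims by blast
  qed
  have fib: "card {p \<in> ?N X \<times> ?N Y. ?s p = y} \<le> card (?N (X \<union> Y))"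
    if y: "y \<in> ?s ` (?N X \<times> ?N Y)" for y
  proof -
    from y obtain a b where ab: "a \<in> ?N X" "b \<in> ?N Y" "y = a - b" by auto
    have c: "a \<in> carrier_vec l" "b \<in> carrier_vec l" using ab by (auto simp: source_kernel_def)
    \<comment> \<open>Relative to the base pair \<open>(a, b)\<close>, every pair in the fiber is
      \<open>(a + d, b + d)\<close>; the common difference \<open>d\<close> determines the pair and
      lies in both kernels.\<close>
    have "inj_on (\<lambda>p. fst p - a) {p \<in> ?N X \<times> ?N Y. ?s p = y}"
    proof (rule inj_onI)
      fix p r assume h: "p \<in> {p \<in> ?N X \<times> ?N Y. ?s p = y}" "r \<in> {p \<in> ?N X \<times> ?N Y. ?s p = y}"
        "fst p - a = fst r - a"
      then have cc: "fst p \<in> carrier_vec l" "snd p \<in> carrier_vec l"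
          "fst r \<in> carrier_vec l" "snd r \<in> carrier_vec l"
        by (auto simp: source_kernel_def)
      have "fst p $ i = fst r $ i \<and> snd p $ i = snd r $ i" if i: "i < l" for i
      proof -
        have "(fst p - a) $ i = (fst r - a) $ i" "(fst p - snd p) $ i = (fst r - snd r) $ i"
          using h by auto
        then show ?thesis using i cc c by auto
      qed
      then have "fst p = fst r" "snd p = snd r"
        using cc by (auto intro!: eq_vecI simp: carrier_vecD)
      then show "p = r" by (rule prod_eqI)
    qed
    moreover have "(\<lambda>p. fst p - a) ` {p \<in> ?N X \<times> ?N Y. ?s p = y} \<subseteq> ?N (X \<union> Y)"
    proof (rule image_subsetI)
      fix q assume q: "q \<in> {p \<in> ?N X \<times> ?N Y. ?s p = y}"
      define p p' where "p = fst q" and "p' = snd q"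
      have h: "p \<in> ?N X" "p' \<in> ?N Y" "p - p' = y" using q by (auto simp: p_def p'_def)
      then have cc: "p \<in> carrier_vec l" "p' \<in> carrier_vec l" by (auto simp: source_kernel_def)
      have e: "p - a = p' - b"
      proof (rule eq_vecI)
        show "dim_vec (p - a) = dim_vec (p' - b)" using c by (simp add: carrier_vecD)
        fix i assume "i < dim_vec (p' - b)"
        then have i: "i < l" using c by (simp add: carrier_vecD)
        have "(p - p') $ i = (a - b) $ i" using h(3) ab(3) by simp
        then have "p $ i - p' $ i = a $ i - b $ i" using i cc c by (simp add: carrier_vecD)
        then have "p $ i - a $ i = p' $ i - b $ i" by (simp add: algebra_simps)
        then show "(p - a) $ i = (p' - b) $ i" using i cc c by (simp add: carrier_vecD)
      qed
      have "p - a \<in> ?N X" using minus_mem_source_kernel[of X A l] dims h ab by blast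
      moreover have "p - a \<in> ?N Y" unfolding e using minus_mem_source_kernel[of Y A l] dims h ab by blast
      ultimately show "fst q - a \<in> ?N (X \<union> Y)"
        unfolding p_def[symmetric] by (auto simp: source_kernel_def)
    qed
    ultimately show ?thesis using card_inj_on_le finite_source_kernel by blast
  qed
  have "card (?N X) * card (?N Y) = card (?N X \<times> ?N Y)" by (simp add: card_cartesian_product)
  also have "\<dots> = (\<Sum>y\<in>?s ` (?N X \<times> ?N Y). card {p \<in> ?N X \<times> ?N Y. ?s p = y})"
    using sum.image_gen[of "?N X \<times> ?N Y" "\<lambda>_. 1::nat" ?s] finite_source_kernel by auto
  also have "\<dots> \<le> (\<Sum>y\<in>?s ` (?N X \<times> ?N Y). card (?N (X \<union> Y)))"
    by (rule sum_mono) (rule fib)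
  also have "\<dots> = card (?s ` (?N X \<times> ?N Y)) * card (?N (X \<union> Y))" by simp
  also have "\<dots> \<le> card (?N (X \<inter> Y)) * card (?N (X \<union> Y))"
    using card_mono[OF finite_source_kernel sub] by simp
  finally show ?thesis by (simp add: mult.commute)
qed

lemma source_entropy_submodular:
  fixes A :: "'v \<Rightarrow> 'q::{finite,field} mat"
  assumes dims: "\<And>i. i \<in> X \<union> Y \<Longrightarrow> dim_col (A i) = l"
  shows "source_entropy l A (X \<union> Y) + source_entropy l A (X \<inter> Y)
    \<le> source_entropy l A X + source_entropy l A Y"
proof -
  let ?L = "log (real CARD('q))" and ?n = "\<lambda>X. real (card (source_kernel l A X))"
  have pos: "0 < ?n X" "0 < ?n Y" "0 < ?n (X \<union> Y)" "0 < ?n (X \<inter> Y)"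
    using dims by (auto intro!: card_source_kernel_pos simp only: of_nat_0_less_iff)
  have "?n X * ?n Y \<le> ?n (X \<union> Y) * ?n (X \<inter> Y)"
    using card_source_kernel_supermodular[of X Y A l] dims by (metis of_nat_le_iff of_nat_mult)
  then have "?L (?n X * ?n Y) \<le> ?L (?n (X \<union> Y) * ?n (X \<inter> Y))"
    using pos one_less_card_field[where 'q = 'q] by simp
  then have "?L (?n X) + ?L (?n Y) \<le> ?L (?n (X \<union> Y)) + ?L (?n (X \<inter> Y))"
    using pos by (simp add: log_mult)
  moreover have "source_entropy l A Z = ?L (card (carrier_vec l :: 'q Matrix.vec set)) - ?L (?n Z)"
    if "Z \<subseteq> X \<union> Y" for Z
    using dims that by (intro source_entropy_eq_log_kernel) auto
  ultimately show ?thesis by (simp add: le_infI1)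
qed

lemma source_entropy_Ints:
  assumes "finite X" "\<And>i. i \<in> X \<Longrightarrow> dim_col (A i) = l"
  shows "source_entropy l A X \<in> \<int>"
proof -
  obtain xs where "set xs = X" using finite_list[OF assms(1)] by blast
  then show ?thesis using source_entropy_eq_rank[of xs A l] assms(2) by auto
qed


section \<open>Tight sets, uncrossing, and the invariant of CoordSatCapFus\<close>

section \<open>Saturation and fusion\<close>

text \<open>Only pairs of intersecting sets are compared, since the value of \<^const>\<open>f_sharp\<close> at \<open>{}\<close> is reset to \<open>0\<close>.\<close>

locale intersecting_submodular =
  fixes V :: "'v set" and H :: "'v set \<Rightarrow> real"
  assumes finite_V: "finite V"
    and submod: "\<lbrakk>X \<subseteq> V; Y \<subseteq> V; X \<inter> Y \<noteq> {}\<rbrakk> \<Longrightarrow> H (X \<union> Y) + H (X \<inter> Y) \<le> H X + H Y"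
begin

text \<open>The slack as a function of the point set instead of the family of blocks, so that
  uncrossing works on subsets of \<open>V\<close>. Sets of gap 0 are the tight (saturated)
  ones.\<close>

definition gap :: "real \<Rightarrow> ('v \<Rightarrow> real) \<Rightarrow> 'v set \<Rightarrow> real" where
  "gap \<alpha> r X = f_sharp V H \<alpha> X - sum r X"

lemma slack_eq_gap: "slack V H \<alpha> r U = gap \<alpha> r (\<Union>U)"
  by (simp add: slack_def gap_def)

text \<open>A nonempty intersection makes all four sets nonempty, so the constant \<alpha> - H(V)
  cancels; the sum of \<open>r\<close> is modular.\<close>

lemma gap_submod:
  assumes "X \<subseteq> V" "Y \<subseteq> V" "X \<inter> Y \<noteq> {}"
  shows "gap \<alpha> r (X \<union> Y) + gap \<alpha> r (X \<inter> Y) \<le> gap \<alpha> r X + gap \<alpha> r Y"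
proof -
  have "finite X" "finite Y" using assms finite_V finite_subset by auto
  then have "sum r (X \<union> Y) + sum r (X \<inter> Y) = sum r X + sum r Y"
    by (simp add: sum.union_inter)
  moreover have "X \<noteq> {}" "Y \<noteq> {}" using assms by auto
  ultimately show ?thesis using submod[OF assms] assms by (simp add: gap_def f_sharp_def)
qed

lemma gap_upd:
  assumes "finite X"
  shows "gap \<alpha> (r(v := r v + \<xi>)) X = (if v \<in> X then gap \<alpha> r X - \<xi> else gap \<alpha> r X)"
proof (cases "v \<in> X")
  case True
  then have "sum (r(v := r v + \<xi>)) (X - {v}) = sum r (X - {v})" by (intro sum.cong) auto
  then show ?thesis using True sum.remove[OF assms True, of r] sum.remove[OF assms True, of "r(v := r v + \<xi>)"]
    by (simp add: gap_def)
next
  case False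
  then have "sum (r(v := r v + \<xi>)) X = sum r X" by (intro sum.cong) auto
  then show ?thesis using False by (simp add: gap_def)
qed

text \<open>Says pointwise that \<open>S\<close> is a union of tight sets.\<close>

definition tight_cover :: "real \<Rightarrow> ('v \<Rightarrow> real) \<Rightarrow> 'v set \<Rightarrow> bool" where
  "tight_cover \<alpha> r S \<longleftrightarrow> (\<forall>u\<in>S. \<exists>Y\<subseteq>S. u \<in> Y \<and> gap \<alpha> r Y = 0)"

text \<open>The last clause makes \<open>P\<close> the finest partition into tight sets.  It is stated for single sets
  \<open>S\<close> rather than for partitions because the former restrict well to subsets of \<open>W\<close>.\<close>

definition fusion_inv :: "real \<Rightarrow> 'v set \<Rightarrow> ('v \<Rightarrow> real) \<Rightarrow> 'v set set \<Rightarrow> bool" where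
  "fusion_inv \<alpha> W r P \<longleftrightarrow> W \<subseteq> V \<and> partition_on W P
     \<and> (\<forall>X\<subseteq>W. 0 \<le> gap \<alpha> r X) \<and> (\<forall>C\<in>P. gap \<alpha> r C = 0)
     \<and> (\<forall>S\<subseteq>W. tight_cover \<alpha> r S \<longrightarrow> tight_cover \<alpha> r (W - S) \<longrightarrow> (\<forall>C\<in>P. C \<subseteq> S \<or> C \<inter> S = {}))"

text \<open>Blocks are absorbed one at a time by uncrossing: a block has gap 0, and its intersection
  with the set built so far lies in \<open>W\<close>, hence has nonnegative gap even if
  \<open>X\<close> contains points outside \<open>W\<close>.\<close>

lemma gap_absorb:
  assumes inv: "fusion_inv \<alpha> W r P" and X: "X \<subseteq> V"
    and D: "D \<subseteq> P" "\<And>C. C \<in> D \<Longrightarrow> C \<inter> X \<noteq> {}"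
  shows "gap \<alpha> r (X \<union> \<Union>D) \<le> gap \<alpha> r X"
proof -
  have W: "W \<subseteq> V" "\<Union>P = W" using inv by (auto simp: fusion_inv_def partition_on_def)
  have "finite W" using W finite_V finite_subset by auto
  then have "finite D" using W D(1) finite_UnionD finite_subset by metis
  then show ?thesis using D
  proof (induction D)
    case (insert C D)
    have C: "C \<subseteq> W" "gap \<alpha> r C = 0" using insert.prems W inv by (auto simp: fusion_inv_def)
    have "gap \<alpha> r ((X \<union> \<Union>D) \<union> C) + gap \<alpha> r ((X \<union> \<Union>D) \<inter> C) \<le> gap \<alpha> r (X \<union> \<Union>D) + gap \<alpha> r C"
    proof (rule gap_submod)
      show "X \<union> \<Union>D \<subseteq> V" using X W insert.prems by blast
      show "C \<subseteq> V" using C W by blast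
      show "(X \<union> \<Union>D) \<inter> C \<noteq> {}" using insert.prems(2)[of C] by auto
    qed
    moreover have "0 \<le> gap \<alpha> r ((X \<union> \<Union>D) \<inter> C)"
      using inv C unfolding fusion_inv_def by (meson inf.coboundedI2)
    moreover have "gap \<alpha> r (X \<union> \<Union>D) \<le> gap \<alpha> r X" using insert by blast
    moreover have "X \<union> \<Union>(insert C D) = (X \<union> \<Union>D) \<union> C" by auto
    ultimately show ?case using C(2) by (metis add.right_neutral add_increasing2 dual_order.trans le_add_same_cancel1 order_refl)
  qed simp
qed

section \<open>The fusion problem of a single step\<close>

definition touched :: "'v set set \<Rightarrow> 'v \<Rightarrow> 'v set \<Rightarrow> 'v set set" where
  "touched P v X = insert {v} {C \<in> P. C \<inter> X \<noteq> {}}"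

lemma touched_cands: "touched P v X \<in> fusion_cands v (insert {v} P)"
  by (auto simp: touched_def fusion_cands_def)

text \<open>Rounding up to whole blocks does not increase the gap. So the minimum over the families
  searched by the algorithm bounds the gap of every subset of \<open>insert v W\<close> containing
  \<open>v\<close>.\<close>

lemma gap_touched:
  assumes inv: "fusion_inv \<alpha> W r P" and X: "X \<subseteq> insert v W" "v \<in> X" and v: "v \<in> V"
  shows "gap \<alpha> r (\<Union>(touched P v X)) \<le> gap \<alpha> r X"
proof -
  let ?D = "{C \<in> P. C \<inter> X \<noteq> {}}"
  have W: "W \<subseteq> V" "\<Union>P = W" using inv by (auto simp: fusion_inv_def partition_on_def)
  then have "X \<subseteq> insert v (\<Union>?D)" using X(1) by blast
  then have "\<Union>(touched P v X) = X \<union> \<Union>?D" using X(2) unfolding touched_def by blast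
  moreover have "gap \<alpha> r (X \<union> \<Union>?D) \<le> gap \<alpha> r X"
    using X(1) W(1) v by (intro gap_absorb[OF inv]) blast+
  ultimately show ?thesis by simp
qed

lemma finite_fusion_cands:
  assumes "fusion_inv \<alpha> W r P"
  shows "finite (fusion_cands v (insert {v} P))"
proof -
  have "finite P" using assms finite_V by (auto simp: fusion_inv_def intro: finite_elements finite_subset)
  then have "finite (Pow (insert {v} P))" by simp
  then show ?thesis by (rule rev_finite_subset) (auto simp: fusion_cands_def)
qed

lemma sat_cap_le:
  assumes "fusion_inv \<alpha> W r P" "U \<in> fusion_cands v (insert {v} P)"
  shows "sat_cap V H \<alpha> r v (insert {v} P) \<le> gap \<alpha> r (\<Union>U)"
  using assms finite_fusion_cands[OF assms(1), of v] by (simp add: sat_cap_def slack_eq_gap[symmetric])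

text \<open>The minimizers are closed under intersection, so the inclusion-minimal one is unique and
  even least. This justifies the \<open>THE\<close> in \<open>fusion_set\<close>.\<close>

lemma fusion_set_least:
  assumes inv: "fusion_inv \<alpha> W r P" and v: "v \<in> V" "v \<notin> W"
  defines "\<xi> \<equiv> sat_cap V H \<alpha> r v (insert {v} P)"
    and "U \<equiv> fusion_set V H \<alpha> r v (insert {v} P)"
  shows "{v} \<in> U" "U \<subseteq> insert {v} P" "gap \<alpha> r (\<Union>U) = \<xi>"
    and "\<And>T. T \<in> fusion_cands v (insert {v} P) \<Longrightarrow> gap \<alpha> r (\<Union>T) = \<xi> \<Longrightarrow> U \<subseteq> T"
proof -
  let ?F = "fusion_cands v (insert {v} P)"
  define M where "M = {U \<in> ?F. slack V H \<alpha> r U = \<xi>}"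
  have W: "W \<subseteq> V" and P: "partition_on W P" using inv by (auto simp: fusion_inv_def)
  have fin: "finite ?F" using finite_fusion_cands[OF inv] .
  have ne: "?F \<noteq> {}" using touched_cands by blast
  have "\<xi> \<in> slack V H \<alpha> r ` ?F" unfolding \<xi>_def sat_cap_def using fin ne by (intro Min_in) auto
  then have Mne: "M \<noteq> {}" by (auto simp: M_def)
  have "finite M" using fin by (auto simp: M_def)
  then obtain U0 where U0: "U0 \<in> M" "\<And>T. T \<in> M \<Longrightarrow> T \<subseteq> U0 \<Longrightarrow> T = U0"
    using finite_has_minimal[OF _ Mne] by metis
  have int: "S \<inter> T \<in> M" if ST: "S \<in> M" "T \<in> M" for S T
  proof -
    have S: "{v} \<in> S" "S \<subseteq> insert {v} P" "gap \<alpha> r (\<Union>S) = \<xi>"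
      and T: "{v} \<in> T" "T \<subseteq> insert {v} P" "gap \<alpha> r (\<Union>T) = \<xi>"
      using ST by (auto simp: M_def fusion_cands_def slack_eq_gap)
    \<comment> \<open>Disjointness of the blocks matches intersections of families with
      intersections of their unions, so submodularity on points transfers to families.\<close>
    have dis: "disjoint (insert {v} P)"
      using P v by (auto simp: partition_on_def pairwise_insert disjnt_def)
    have eq: "\<Union>(S \<inter> T) = \<Union>S \<inter> \<Union>T"
    proof
      show "\<Union>S \<inter> \<Union>T \<subseteq> \<Union>(S \<inter> T)"
      proof
        fix x assume "x \<in> \<Union>S \<inter> \<Union>T"
        then obtain B C where BC: "x \<in> B" "B \<in> S" "x \<in> C" "C \<in> T" by blast
        then have "B = C" using dis S(2) T(2) unfolding disjoint_def by blast
        then show "x \<in> \<Union>(S \<inter> T)" using BC by blast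
      qed
    qed blast
    have sub: "\<Union>S \<subseteq> V" "\<Union>T \<subseteq> V" "\<Union>S \<inter> \<Union>T \<noteq> {}"
      using S T P W v by (auto simp: partition_on_def)
    have cands: "S \<union> T \<in> ?F" "S \<inter> T \<in> ?F" using S T by (auto simp: fusion_cands_def)
    have "gap \<alpha> r (\<Union>(S \<union> T)) + gap \<alpha> r (\<Union>(S \<inter> T)) \<le> \<xi> + \<xi>"
      using gap_submod[OF sub, of \<alpha> r] S(3) T(3) eq by (simp add: Union_Un_distrib)
    then have "gap \<alpha> r (\<Union>(S \<inter> T)) = \<xi>"
      using sat_cap_le[OF inv cands(1)] sat_cap_le[OF inv cands(2)] unfolding \<xi>_def by linarith
    then show ?thesis using cands by (simp add: M_def slack_eq_gap)
  qed
  have least: "U0 \<subseteq> T" if "T \<in> M" for T using U0 int[OF U0(1) that] by blast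
  have "U = (THE U. U \<in> M \<and> (\<forall>W\<in>M. \<not> W \<subset> U))"
    by (simp add: U_def fusion_set_def M_def \<xi>_def)
  also have "\<dots> = U0" using U0 least by (intro the_equality) blast+
  finally have "U = U0" .
  then show "{v} \<in> U" "U \<subseteq> insert {v} P" "gap \<alpha> r (\<Union>U) = \<xi>"
    using U0(1) by (auto simp: M_def fusion_cands_def slack_eq_gap)
  show "U \<subseteq> T" if "T \<in> ?F" "gap \<alpha> r (\<Union>T) = \<xi>" for T
    using least[of T] that \<open>U = U0\<close> by (simp add: M_def slack_eq_gap)
qed

text \<open>Raising \<open>r v\<close> by the minimum \<xi> lowers exactly the gaps of sets
  containing \<open>v\<close>, and none below 0. Leastness of the fused family keeps the partition
  finest. The last claim supplies the tight set that determines the new coordinate.\<close>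

lemma fusion_step_inv:
  assumes inv: "fusion_inv \<alpha> W r P" and v: "v \<in> V" "v \<notin> W"
    and step: "fusion_step V H \<alpha> v (r, P) = (r', P')"
  shows "fusion_inv \<alpha> (insert v W) r' P'"
    and "\<And>i. i \<noteq> v \<Longrightarrow> r' i = r i"
    and "\<exists>Y\<subseteq>insert v W. v \<in> Y \<and> gap \<alpha> r' Y = 0"
proof -
  define \<xi> where "\<xi> = sat_cap V H \<alpha> r v (insert {v} P)"
  define U where "U = fusion_set V H \<alpha> r v (insert {v} P)"
  note U = fusion_set_least[OF inv v, folded \<xi>_def U_def]
  have W: "W \<subseteq> V" and P: "partition_on W P"
    and feas: "\<And>X. X \<subseteq> W \<Longrightarrow> 0 \<le> gap \<alpha> r X" and tight: "\<And>C. C \<in> P \<Longrightarrow> gap \<alpha> r C = 0"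
    using inv by (auto simp: fusion_inv_def)
  have fin: "finite X" if "X \<subseteq> insert v W" for X
    using that W v finite_V by (meson finite_subset insert_subset)
  have UP: "\<Union>P = W" using P by (simp add: partition_on_def)
  have r': "r' = r(v := r v + \<xi>)" and P': "P' = insert (\<Union>U) (insert {v} P - U)"
    using step by (auto simp: fusion_step_def Let_def \<xi>_def U_def)
  have g: "gap \<alpha> r' X = (if v \<in> X then gap \<alpha> r X - \<xi> else gap \<alpha> r X)" if "X \<subseteq> insert v W" for X
    unfolding r' using gap_upd[OF fin[OF that]] by simp
  have UU: "\<Union>U \<subseteq> insert v W" "v \<in> \<Union>U" "gap \<alpha> r' (\<Union>U) = 0"
  proof -
    show 1: "\<Union>U \<subseteq> insert v W" using U(2) UP by auto
    show 2: "v \<in> \<Union>U" using U(1) by auto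
    show "gap \<alpha> r' (\<Union>U) = 0" using g[OF 1] 2 U(3) by simp
  qed
  show "\<And>i. i \<noteq> v \<Longrightarrow> r' i = r i" by (simp add: r')
  show "\<exists>Y\<subseteq>insert v W. v \<in> Y \<and> gap \<alpha> r' Y = 0" using UU by blast
  have feas': "0 \<le> gap \<alpha> r' X" if X: "X \<subseteq> insert v W" for X
  proof (cases "v \<in> X")
    case True
    have "\<xi> \<le> gap \<alpha> r (\<Union>(touched P v X))"
      unfolding \<xi>_def by (rule sat_cap_le[OF inv touched_cands])
    also have "\<dots> \<le> gap \<alpha> r X" by (rule gap_touched[OF inv X True v(1)])
    finally show ?thesis using g[OF X] True by simp
  next
    case False
    then show ?thesis using g[OF X] feas[of X] X by auto
  qed
  have part: "partition_on (insert v W) P'"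
  proof (rule partition_onI)
    show "\<Union>P' = insert v W" using U(1,2) UP unfolding P' by auto
    show "{} \<notin> P'" using P U(1) unfolding P' partition_on_def by auto
    have dis: "disjnt p q" if "p \<in> insert {v} P" "q \<in> insert {v} P" "p \<noteq> q" for p q
      using that P v UP by (auto simp: partition_on_def pairwise_def disjnt_def)
    have UD: "disjnt q (\<Union>U)" if "q \<in> insert {v} P - U" for q
      unfolding disjnt_Union2
    proof
      fix B assume "B \<in> U"
      then show "disjnt q B" using that U(2) by (intro dis) auto
    qed
    show "disjnt p q" if pq: "p \<in> P'" "q \<in> P'" "p \<noteq> q" for p q
    proof -
      consider "p = \<Union>U" "q \<in> insert {v} P - U" | "q = \<Union>U" "p \<in> insert {v} P - U"
        | "p \<in> insert {v} P" "q \<in> insert {v} P"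
        using pq unfolding P' by blast
      then show ?thesis
      proof cases
        case 1
        then show ?thesis using UD[of q] by (simp add: disjnt_sym)
      qed (use UD[of p] dis[of p q] pq(3) in simp_all)
    qed
  qed
  have tight': "gap \<alpha> r' C = 0" if "C \<in> P'" for C
  proof (cases "C = \<Union>U")
    case False
    then have "C \<in> P" using that U(1) unfolding P' by auto
    moreover from this have "C \<subseteq> insert v W" "v \<notin> C" using UP v(2) by blast+
    ultimately show ?thesis using g tight by simp
  qed (use UU in simp)
  \<comment> \<open>Without \<open>v\<close>, the set \<open>S\<close> and its complement are unions
    of sets tight for the old rates, so no old block crosses \<open>S\<close>. A tight set around
    \<open>v\<close> inside \<open>S\<close> then keeps the fused block inside
    \<open>S\<close>.\<close>
  have cross: "C \<subseteq> S \<or> C \<inter> S = {}"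
    if S: "S \<subseteq> insert v W" "v \<in> S" "tight_cover \<alpha> r' S" "tight_cover \<alpha> r' (insert v W - S)"
      and C: "C \<in> P'" for S C
  proof -
    have "tight_cover \<alpha> r (S - {v})"
      unfolding tight_cover_def
    proof
      fix u assume u: "u \<in> S - {v}"
      then obtain Y where Y: "Y \<subseteq> S" "u \<in> Y" "gap \<alpha> r' Y = 0"
        using S(3) by (auto simp: tight_cover_def)
      obtain B where B: "B \<in> P" "u \<in> B" using u S(1) UP by auto
      have Bs: "B \<subseteq> insert v W" "v \<notin> B" "B \<subseteq> W" using B UP v(2) by auto
      \<comment> \<open>If \<open>Y\<close> contains \<open>v\<close>, it need not be tight for
        \<open>r\<close>. Its intersection with the old block \<open>B\<close> of \<open>u\<close>
        avoids \<open>v\<close> and is tight by uncrossing.\<close>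
      have "gap \<alpha> r' (Y \<union> B) + gap \<alpha> r' (Y \<inter> B) \<le> gap \<alpha> r' Y + gap \<alpha> r' B"
        using Y B Bs S(1) W v(1) by (intro gap_submod) auto
      moreover have "gap \<alpha> r' B = 0" using g[OF Bs(1)] Bs tight[OF B(1)] by simp
      moreover have "0 \<le> gap \<alpha> r' (Y \<union> B)" "0 \<le> gap \<alpha> r' (Y \<inter> B)"
        using Y S(1) Bs by (auto intro!: feas')
      ultimately have "gap \<alpha> r' (Y \<inter> B) = 0" using Y(3) by linarith
      moreover have "Y \<inter> B \<subseteq> insert v W" using Bs by blast
      ultimately have "gap \<alpha> r (Y \<inter> B) = 0" using g[of "Y \<inter> B"] Bs(2) by simp
      then show "\<exists>Y\<subseteq>S - {v}. u \<in> Y \<and> gap \<alpha> r Y = 0"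
        using Y B Bs by (intro exI[of _ "Y \<inter> B"]) auto
    qed
    moreover have "tight_cover \<alpha> r (W - (S - {v}))"
    proof -
      have eq: "W - (S - {v}) = insert v W - S" using S(2) v(2) by auto
      show ?thesis unfolding tight_cover_def
      proof
        fix u assume "u \<in> W - (S - {v})"
        then obtain Y where Y: "Y \<subseteq> insert v W - S" "u \<in> Y" "gap \<alpha> r' Y = 0"
          using S(4) unfolding eq by (auto simp: tight_cover_def)
        then have "Y \<subseteq> insert v W" "v \<notin> Y" using S(2) by blast+
        then have "gap \<alpha> r Y = 0" using g[of Y] Y(3) by simp
        then show "\<exists>Y\<subseteq>W - (S - {v}). u \<in> Y \<and> gap \<alpha> r Y = 0" using Y unfolding eq by blast
      qed
    qed
    moreover have "S - {v} \<subseteq> W" using S(1) by auto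
    ultimately have old: "B \<subseteq> S - {v} \<or> B \<inter> (S - {v}) = {}" if "B \<in> P" for B
      using inv that unfolding fusion_inv_def by blast
    obtain Y where Y: "Y \<subseteq> S" "v \<in> Y" "gap \<alpha> r' Y = 0"
      using S(2,3) by (auto simp: tight_cover_def)
    have Ys: "Y \<subseteq> insert v W" using Y S by blast
    \<comment> \<open>A set through \<open>v\<close> that is tight for \<open>r'\<close> has gap
      \<xi> for \<open>r\<close>, so rounding it up gives a minimizer, which contains
      \<open>U\<close> by leastness.\<close>
    have "gap \<alpha> r (\<Union>(touched P v Y)) \<le> \<xi>"
      using gap_touched[OF inv Ys Y(2) v(1)] g[OF Ys] Y by simp
    moreover have "\<xi> \<le> gap \<alpha> r (\<Union>(touched P v Y))"
      unfolding \<xi>_def by (rule sat_cap_le[OF inv touched_cands])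
    ultimately have UT: "U \<subseteq> touched P v Y" using touched_cands by (intro U(4)) auto
    have "B \<subseteq> S" if B: "B \<in> P" "B \<inter> Y \<noteq> {}" for B
    proof -
      have "v \<notin> B" using B UP v(2) by auto
      then have "B \<inter> (S - {v}) \<noteq> {}" using B(2) Y(1) by auto
      then show ?thesis using old[OF B(1)] by auto
    qed
    then have US: "\<Union>U \<subseteq> S" using UT S(2) unfolding touched_def by blast
    show ?thesis
    proof (cases "C = \<Union>U")
      case False
      then have "C \<in> P" using C U(1) unfolding P' by auto
      moreover from this have "v \<notin> C" using UP v(2) by auto
      ultimately show ?thesis using old[of C] by auto
    qed (use US in simp)
  qed
  \<comment> \<open>The condition is symmetric in \<open>S\<close> and its complement, so
    \<open>v\<close> may be assumed to lie in \<open>S\<close>.\<close>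
  have "C \<subseteq> S \<or> C \<inter> S = {}"
    if S: "S \<subseteq> insert v W" "tight_cover \<alpha> r' S" "tight_cover \<alpha> r' (insert v W - S)"
      and C: "C \<in> P'" for S C
  proof (cases "v \<in> S")
    case True
    then show ?thesis using cross[of S C] S C by blast
  next
    case False
    have "insert v W - (insert v W - S) = S" using S(1) by auto
    then have "C \<subseteq> insert v W - S \<or> C \<inter> (insert v W - S) = {}"
      using cross[of "insert v W - S" C] S C False by auto
    moreover have "C \<subseteq> insert v W" using C part by (auto simp: partition_on_def)
    ultimately show ?thesis by blast
  qed
  then show "fusion_inv \<alpha> (insert v W) r' P'"
    unfolding fusion_inv_def using W v(1) part feas' tight' by blast
qed

text \<open>The tight set is solved for \<open>r v\<close>. The factor \<open>c\<close> stays
  general to serve both 1 and |P| - 1.\<close>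

lemma Ints_mult_step:
  fixes c :: real
  assumes H: "\<forall>X\<subseteq>V. c * f_sharp V H \<alpha> X \<in> \<int>"
    and W: "insert v W \<subseteq> V" "v \<notin> W" and r: "\<forall>i\<in>W. c * r i \<in> \<int>"
    and Y: "Y \<subseteq> insert v W" "v \<in> Y" "gap \<alpha> r Y = 0"
  shows "c * r v \<in> \<int>"
proof -
  have "finite Y" using Y W finite_V by (meson finite_subset order_trans)
  then have "r v = f_sharp V H \<alpha> Y - sum r (Y - {v})"
    using Y sum.remove[of Y v r] by (simp add: gap_def)
  then have "c * r v = c * f_sharp V H \<alpha> Y - (\<Sum>i\<in>Y - {v}. c * r i)"
    by (simp add: right_diff_distrib sum_distrib_left)
  moreover have "(\<Sum>i\<in>Y - {v}. c * r i) \<in> \<int>" using r Y by (intro Ints_sum) auto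
  moreover have "c * f_sharp V H \<alpha> Y \<in> \<int>" using H Y W by blast
  ultimately show ?thesis by simp
qed

lemma fold_fusion_step_inv:
  assumes "fusion_inv \<alpha> W r P" "distinct vs" "set vs \<inter> W = {}" "set vs \<subseteq> V"
    and "fold (fusion_step V H \<alpha>) vs (r, P) = (r', P')"
  shows "fusion_inv \<alpha> (W \<union> set vs) r' P'"
    and "\<And>c::real. \<forall>X\<subseteq>V. c * f_sharp V H \<alpha> X \<in> \<int> \<Longrightarrow> \<forall>i\<in>W. c * r i \<in> \<int> \<Longrightarrow>
      \<forall>i\<in>W \<union> set vs. c * r' i \<in> \<int>"
proof -
  have "fusion_inv \<alpha> (W \<union> set vs) r' P' \<and>
    (\<forall>c::real. (\<forall>X\<subseteq>V. c * f_sharp V H \<alpha> X \<in> \<int>) \<longrightarrow> (\<forall>i\<in>W. c * r i \<in> \<int>) \<longrightarrow>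
      (\<forall>i\<in>W \<union> set vs. c * r' i \<in> \<int>))"
    using assms
  proof (induction vs arbitrary: W r P)
    case (Cons v vs)
    obtain r1 P1 where step: "fusion_step V H \<alpha> v (r, P) = (r1, P1)" by fastforce
    have v: "v \<in> V" "v \<notin> W" using Cons.prems by auto
    note s = fusion_step_inv[OF Cons.prems(1) v step]
    have W: "insert v W \<subseteq> V" using s(1) by (simp add: fusion_inv_def)
    have IH: "fusion_inv \<alpha> (insert v W \<union> set vs) r' P' \<and>
      (\<forall>c::real. (\<forall>X\<subseteq>V. c * f_sharp V H \<alpha> X \<in> \<int>) \<longrightarrow> (\<forall>i\<in>insert v W. c * r1 i \<in> \<int>) \<longrightarrow>
        (\<forall>i\<in>insert v W \<union> set vs. c * r' i \<in> \<int>))"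
      using Cons.prems step by (intro Cons.IH[OF s(1)]) auto
    have "\<forall>i\<in>insert v W. c * r1 i \<in> \<int>"
      if c: "\<forall>X\<subseteq>V. c * f_sharp V H \<alpha> X \<in> \<int>" "\<forall>i\<in>W. c * r i \<in> \<int>" for c :: real
    proof -
      have "\<forall>i\<in>W. c * r1 i \<in> \<int>" using c(2) s(2) v(2) by metis
      then show ?thesis using Ints_mult_step[OF c(1) W v(2)] s(3) by auto
    qed
    then show ?case using IH by (simp add: Un_assoc)
  qed auto
  then show "fusion_inv \<alpha> (W \<union> set vs) r' P'"
    and "\<And>c::real. \<forall>X\<subseteq>V. c * f_sharp V H \<alpha> X \<in> \<int> \<Longrightarrow> \<forall>i\<in>W. c * r i \<in> \<int> \<Longrightarrow>
      \<forall>i\<in>W \<union> set vs. c * r' i \<in> \<int>" by blast+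
qed

lemma fusion_inv_singleton:
  assumes "v \<in> V" "r v = f_sharp V H \<alpha> {v}"
  shows "fusion_inv \<alpha> {v} r {{v}}"
  using assms by (auto simp: fusion_inv_def partition_on_def subset_singleton_iff gap_def f_sharp_def)

lemma coord_sat_cap_fus_inv:
  assumes vs: "linear_ordering V vs" and ne: "V \<noteq> {}"
    and out: "coord_sat_cap_fus V H \<alpha> vs = (r, P)"
  shows "fusion_inv \<alpha> V r P"
    and "\<And>c::real. \<forall>X\<subseteq>V. c * f_sharp V H \<alpha> X \<in> \<int> \<Longrightarrow> \<forall>i\<in>V. c * r i \<in> \<int>"
proof -
  obtain w ws where ws: "vs = w # ws" using vs ne by (cases vs) (auto simp: linear_ordering_def)
  have w: "w \<in> V" "distinct ws" "set ws \<inter> {w} = {}" "set ws \<subseteq> V" "{w} \<union> set ws = V"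
    using vs by (auto simp: linear_ordering_def ws)
  define r0 where "r0 = (\<lambda>i. (\<alpha> - H V) * indicator V i)(w := f_sharp V H \<alpha> {w})"
  have fold: "fold (fusion_step V H \<alpha>) ws (r0, {{w}}) = (r, P)"
    using out by (simp add: coord_sat_cap_fus_def ws r0_def)
  have "fusion_inv \<alpha> {w} r0 {{w}}" using w by (intro fusion_inv_singleton) (simp_all add: r0_def)
  note inv = fold_fusion_step_inv[OF this w(2-4) fold, unfolded w(5)]
  show "fusion_inv \<alpha> V r P" by (rule inv(1))
  show "\<forall>i\<in>V. c * r i \<in> \<int>" if "\<forall>X\<subseteq>V. c * f_sharp V H \<alpha> X \<in> \<int>" for c :: real
    using inv(2)[of c] that w(1) by (simp add: r0_def)
qed

end

section \<open>Duality between rate vectors and partitions\<close>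

section \<open>Optimal rates and the modified decomposition algorithm\<close>

locale omniscience_problem = intersecting_submodular +
  assumes card_V: "card V > 1"
begin

text \<open>The dual value; \<open>R_ACO_eq\<close> identifies it with the optimal total
  rate.\<close>

definition max_rate :: real where
  "max_rate = Max (partition_rate V H ` {P. partition_on V P \<and> card P > 1})"

lemma V_nonempty: "V \<noteq> {}"
  using card_V by auto

lemma finite_partitions: "finite {P. partition_on V P \<and> card P > 1}"
  by (rule finite_subset[OF _ finitely_many_partition_on[OF finite_V]]) auto

lemma singletons_partition: "partition_on V ((\<lambda>m. {m}) ` V)" "card ((\<lambda>m. {m}) ` V) > 1"
  using card_V by (auto simp: partition_on_singletons card_image)

lemma rate_le_max_rate: "partition_on V P \<Longrightarrow> card P > 1 \<Longrightarrow> partition_rate V H P \<le> max_rate"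
  unfolding max_rate_def using finite_partitions by (intro Max_ge) auto

lemma max_rate_attained:
  obtains P where "partition_on V P" "card P > 1" "partition_rate V H P = max_rate"
proof -
  have "max_rate \<in> partition_rate V H ` {P. partition_on V P \<and> card P > 1}"
    unfolding max_rate_def using finite_partitions singletons_partition by (intro Max_in) auto
  then show ?thesis using that by auto
qed

lemma rate_maximizer_iff:
  "rate_maximizer V H P \<longleftrightarrow> partition_on V P \<and> card P > 1 \<and> partition_rate V H P = max_rate"
proof -
  obtain Q where Q: "partition_on V Q" "card Q > 1" "partition_rate V H Q = max_rate"
    by (rule max_rate_attained)
  show ?thesis
    unfolding rate_maximizer_def is_arg_max_def
    using Q rate_le_max_rate by (metis not_less order_le_less order_less_irrefl)
qed

lemma sum_rate: "card P > 1 \<Longrightarrow> (\<Sum>C\<in>P. H V - H C) = (real (card P) - 1) * partition_rate V H P"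
  by (simp add: partition_rate_def sum_divide_distrib[symmetric])

text \<open>In this form the sign of \<alpha> - \<phi>(P) decides whether the sum lies above or
  below \<alpha>; every comparison of \<alpha> with \<open>max_rate\<close> rests on it.\<close>

lemma sum_f_sharp_partition:
  assumes "partition_on V P" "card P > 1"
  shows "(\<Sum>C\<in>P. f_sharp V H \<alpha> C) = \<alpha> + (real (card P) - 1) * (\<alpha> - partition_rate V H P)"
proof -
  have "(\<Sum>C\<in>P. f_sharp V H \<alpha> C) = (\<Sum>C\<in>P. \<alpha> - (H V - H C))"
    using assms(1) by (intro sum.cong) (auto simp: f_sharp_def partition_on_def)
  also have "\<dots> = real (card P) * \<alpha> - (\<Sum>C\<in>P. H V - H C)" by (simp only: sum_subtractf sum_constant)
  finally show ?thesis by (simp add: sum_rate[OF assms(2)] algebra_simps)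
qed

text \<open>The identity above does not cover the one-block partition, whose sum is \<alpha>
  itself.\<close>

lemma partition_cases:
  assumes "partition_on V P"
  obtains "P = {V}" | "card P > 1"
proof -
  have fin: "finite P" using assms finite_V finite_elements by blast
  have "P \<noteq> {}" using assms V_nonempty by (auto simp: partition_on_def)
  then have "0 < card P" using fin by (simp add: card_gt_0_iff)
  moreover have "P = {V}" if "card P = 1"
    using that assms by (auto simp: card_1_singleton_iff partition_on_def)
  ultimately show ?thesis using that by linarith
qed

section \<open>Consequences of the invariant on all of \<open>V\<close>\<close>

context
  fixes \<alpha> r P
  assumes inv: "fusion_inv \<alpha> V r P"
begin

lemma inv_partition: "partition_on V P"
  using inv by (simp add: fusion_inv_def)

lemma inv_le: "X \<subseteq> V \<Longrightarrow> sum r X \<le> f_sharp V H \<alpha> X"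
  using inv by (simp add: fusion_inv_def gap_def)

lemma inv_total_le: "sum r V \<le> \<alpha>"
  using inv_le[of V] V_nonempty by (simp add: f_sharp_def)

text \<open>Together with \<open>inv_sum_eq\<close> this shows that r(V) is the Dilworth truncation
  of \<open>f_sharp\<close> at \<open>V\<close>, attained by \<open>P\<close>.\<close>

lemma inv_sum_le:
  assumes "partition_on V Q"
  shows "sum r V \<le> (\<Sum>C\<in>Q. f_sharp V H \<alpha> C)"
  unfolding sum.partition[OF finite_V assms]
  using assms by (intro sum_mono inv_le) (auto simp: partition_on_def)

lemma inv_sum_eq: "sum r V = (\<Sum>C\<in>P. f_sharp V H \<alpha> C)"
  unfolding sum.partition[OF finite_V inv_partition]
  using inv by (intro sum.cong) (auto simp: fusion_inv_def gap_def)

lemma inv_total: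
  assumes "max_rate \<le> \<alpha>"
  shows "sum r V = \<alpha>"
proof (rule antisym[OF inv_total_le])
  show "\<alpha> \<le> sum r V"
  proof (cases rule: partition_cases[OF inv_partition])
    case 1
    then show ?thesis using inv_sum_eq V_nonempty by (simp add: f_sharp_def)
  next
    case 2
    have "0 \<le> (real (card P) - 1) * (\<alpha> - partition_rate V H P)"
      using 2 assms rate_le_max_rate[OF inv_partition 2] by simp
    then show ?thesis by (simp add: inv_sum_eq sum_f_sharp_partition[OF inv_partition 2])
  qed
qed

lemma inv_R_CO:
  assumes "max_rate \<le> \<alpha>"
  shows "r \<in> R_CO V H"
  unfolding R_CO_def
proof (intro CollectI allI impI)
  fix X assume X: "X \<subset> V"
  then have "sum r (V - X) + sum r X = \<alpha>"
    using inv_total[OF assms] finite_V by (metis psubset_imp_subset sum.subset_diff)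
  \<comment> \<open>Properness of \<open>X\<close> makes \<open>V - X\<close> nonempty, so
    \<open>f_sharp\<close> is not reset to 0 there.\<close>
  moreover have "sum r (V - X) \<le> \<alpha> - H V + H (V - X)"
    using inv_le[of "V - X"] X by (auto simp: f_sharp_def split: if_splits)
  moreover have "X \<union> (V - X) = V" using X by auto
  ultimately show "cond_entropy H X (V - X) \<le> sum r X" by (simp add: cond_entropy_def)
qed

text \<open>A maximizer of \<phi> forces r(V) < \<alpha>. As r(V) is also the sum over
  \<open>P\<close>, the partition is not \<open>{V}\<close>, and the identity read backwards gives
  the gain.\<close>

lemma inv_improves:
  assumes "\<alpha> < max_rate"
  shows "card P > 1" "\<alpha> < partition_rate V H P"
proof -
  obtain Q where Q: "partition_on V Q" "card Q > 1" "partition_rate V H Q = max_rate"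
    by (rule max_rate_attained)
  have "(real (card Q) - 1) * (\<alpha> - max_rate) < 0" using Q assms by (intro mult_pos_neg) auto
  then have less: "sum r V < \<alpha>"
    using inv_sum_le[OF Q(1)] sum_f_sharp_partition[OF Q(1,2), of \<alpha>] Q(3) by simp
  show c: "card P > 1"
  proof (cases rule: partition_cases[OF inv_partition])
    case 1
    then show ?thesis using less inv_sum_eq V_nonempty by (simp add: f_sharp_def)
  qed
  have "(real (card P) - 1) * (\<alpha> - partition_rate V H P) < 0"
    using less unfolding inv_sum_eq sum_f_sharp_partition[OF inv_partition c] by simp
  then show "\<alpha> < partition_rate V H P" using c by (simp add: mult_less_0_iff)
qed

text \<open>A block \<open>B\<close> of \<open>Q\<close> and its complement are both unions of tight
  sets, so the last clause of \<open>fusion_inv\<close> forbids blocks of \<open>P\<close> to cross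
  \<open>B\<close>.\<close>

lemma inv_refines:
  assumes Q: "partition_on V Q" and tight: "\<And>C. C \<in> Q \<Longrightarrow> sum r C = f_sharp V H \<alpha> C"
  shows "refines V P Q"
  unfolding refines_def
proof (intro conjI ballI inv_partition Q)
  fix C assume C: "C \<in> P"
  then obtain x where x: "x \<in> C" "x \<in> V"
    using inv_partition unfolding partition_on_def by (metis UnionI ex_in_conv)
  then obtain B where B: "B \<in> Q" "x \<in> B" using Q by (auto simp: partition_on_def)
  have sub: "B \<subseteq> V" using B Q by (auto simp: partition_on_def)
  have "tight_cover \<alpha> r B" using B tight by (auto simp: tight_cover_def gap_def)
  moreover have "tight_cover \<alpha> r (V - B)"
    unfolding tight_cover_def
  proof
    fix u assume u: "u \<in> V - B"
    then obtain Y where Y: "Y \<in> Q" "u \<in> Y" using Q by (auto simp: partition_on_def)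
    then have "Y \<inter> B = {}" using Q B u by (auto simp: partition_on_def disjoint_def)
    moreover have "Y \<subseteq> V" using Y Q by (auto simp: partition_on_def)
    ultimately show "\<exists>Y\<subseteq>V - B. u \<in> Y \<and> gap \<alpha> r Y = 0"
      using Y tight by (intro exI[of _ Y]) (auto simp: gap_def)
  qed
  ultimately have "C \<subseteq> B \<or> C \<inter> B = {}" using inv sub C unfolding fusion_inv_def by blast
  then show "\<exists>B\<in>Q. C \<subseteq> B" using B x by blast
qed

text \<open>For a maximizer the sum of \<open>f_sharp\<close> equals r(V), so the nonnegative gaps
  of its blocks add up to 0. Hence all of them are tight, and \<open>P\<close> refines every
  maximizer.\<close>

lemma inv_fundamental:
  assumes \<alpha>: "\<alpha> = max_rate"
  shows "card P > 1" "partition_rate V H P = max_rate" "fundamental_partition V H = P"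
proof -
  have total: "sum r V = max_rate" using inv_total \<alpha> by simp
  have ref: "refines V P Q" if "rate_maximizer V H Q" for Q
  proof -
    have Q: "partition_on V Q" "card Q > 1" "partition_rate V H Q = max_rate"
      using that by (auto simp: rate_maximizer_iff)
    have le: "sum r C \<le> f_sharp V H \<alpha> C" if "C \<in> Q" for C
      using that Q(1) by (intro inv_le) (auto simp: partition_on_def)
    have "(\<Sum>C\<in>Q. f_sharp V H \<alpha> C - sum r C) = 0"
      using total sum_f_sharp_partition[OF Q(1,2), of \<alpha>] Q(3) \<alpha> sum.partition[OF finite_V Q(1), of r]
      by (simp add: sum_subtractf)
    moreover have "finite Q" using Q(1) finite_V finite_elements by blast
    ultimately have "\<forall>C\<in>Q. f_sharp V H \<alpha> C - sum r C = 0"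
      using le by (subst (asm) sum_nonneg_eq_0_iff) auto
    then show ?thesis using Q(1) by (intro inv_refines) auto
  qed
  show c: "card P > 1"
  proof (cases rule: partition_cases[OF inv_partition])
    case 1
    \<comment> \<open>If \<open>P\<close> were \<open>{V}\<close>, any maximizer refined by it would
      be \<open>{V}\<close> as well.\<close>
    obtain Q where Q: "partition_on V Q" "card Q > 1" "partition_rate V H Q = max_rate"
      by (rule max_rate_attained)
    then have "refines V P Q" by (intro ref) (simp add: rate_maximizer_iff)
    then obtain Y where "Y \<in> Q" "V \<subseteq> Y" using 1 by (auto simp: refines_def)
    then have "V \<in> Q" using Q(1) unfolding partition_on_def by (metis Union_upper subset_antisym)
    then have "C = V" if "C \<in> Q" for C
      using that Q(1) unfolding partition_on_def disjoint_def by (metis Int_absorb2 Union_upper)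
    then have "Q = {V}" using \<open>V \<in> Q\<close> by blast
    then show ?thesis using Q(2) by simp
  qed
  have "(real (card P) - 1) * (\<alpha> - partition_rate V H P) = 0"
    using total \<alpha> unfolding inv_sum_eq sum_f_sharp_partition[OF inv_partition c] by simp
  then show "partition_rate V H P = max_rate" using c \<alpha> by simp
  then have "rate_maximizer V H P" using inv_partition c by (simp add: rate_maximizer_iff)
  then show "fundamental_partition V H = P"
    unfolding fundamental_partition_def using ref refines_asym by (intro the_equality) blast+
qed

end

text \<open>Add the constraints for the complements of the blocks of a maximizing partition; each
  point of \<open>V\<close> lies in |Q| - 1 of them.\<close>

lemma R_CO_total_ge:
  assumes r: "r \<in> R_CO V H"
  shows "max_rate \<le> sum r V"
proof -
  obtain Q where Q: "partition_on V Q" "card Q > 1" "partition_rate V H Q = max_rate"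
    by (rule max_rate_attained)
  have "(real (card Q) - 1) * max_rate = (\<Sum>C\<in>Q. H V - H C)" using sum_rate[OF Q(2)] Q(3) by simp
  also have "\<dots> \<le> (\<Sum>C\<in>Q. sum r V - sum r C)"
  proof (rule sum_mono)
    fix C assume C: "C \<in> Q"
    then have sub: "C \<subseteq> V" "C \<noteq> {}" using Q(1) by (auto simp: partition_on_def)
    then have "V - C \<subset> V" "V - (V - C) = C" by auto
    then have "cond_entropy H (V - C) C \<le> sum r (V - C)"
      using r unfolding R_CO_def by (metis (mono_tags, lifting) mem_Collect_eq)
    moreover have "(V - C) \<union> C = V" using sub by auto
    ultimately show "H V - H C \<le> sum r V - sum r C"
      using sum_diff[OF finite_V sub(1), of r] by (simp add: cond_entropy_def)
  qed
  also have "\<dots> = (real (card Q) - 1) * sum r V"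
    using sum.partition[OF finite_V Q(1), of r] by (simp add: sum_subtractf algebra_simps)
  finally show ?thesis using Q(2) by simp
qed

section \<open>Optimal totals, attained by the output of the algorithm\<close>

lemma ex_linear_ordering: "\<exists>vs. linear_ordering V vs"
  unfolding linear_ordering_def using finite_distinct_list[OF finite_V] by blast

lemma R_ACO_eq: "R_ACO V H = max_rate"
proof -
  obtain vs where vs: "linear_ordering V vs" using ex_linear_ordering by blast
  obtain r P where out: "coord_sat_cap_fus V H max_rate vs = (r, P)" by fastforce
  note inv = coord_sat_cap_fus_inv(1)[OF vs V_nonempty out]
  show ?thesis unfolding R_ACO_def
  proof (rule Least_equality)
    show "max_rate \<in> (\<lambda>r. sum r V) ` R_CO V H"
      using inv_R_CO[OF inv] inv_total[OF inv] by (intro image_eqI[of _ _ r]) auto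
    show "max_rate \<le> s" if "s \<in> (\<lambda>r. sum r V) ` R_CO V H" for s
      using that R_CO_total_ge by blast
  qed
qed

lemma coord_sat_cap_fus_integral:
  assumes int: "\<And>X. X \<subseteq> V \<Longrightarrow> H X \<in> \<int>" and vs: "linear_ordering V vs"
    and out: "coord_sat_cap_fus V H \<alpha> vs = (r, P)" and k: "real k * \<alpha> \<in> \<int>"
  shows "integral_on V (\<lambda>i. real k * r i)"
proof -
  have "real k * f_sharp V H \<alpha> X \<in> \<int>" if "X \<subseteq> V" for X
    using int[OF that] int[of V] k by (simp add: f_sharp_def distrib_left right_diff_distrib)
  then show ?thesis unfolding integral_on_def
    using coord_sat_cap_fus_inv(2)[OF vs V_nonempty out] by blast
qed

lemma coord_sat_cap_fus_integral_opt:
  assumes int: "\<And>X. X \<subseteq> V \<Longrightarrow> H X \<in> \<int>" and vs: "linear_ordering V vs"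
    and out: "coord_sat_cap_fus V H (of_int \<lceil>max_rate\<rceil>) vs = (r, P)"
  shows "r \<in> R_CO V H" "sum r V = of_int \<lceil>max_rate\<rceil>" "integral_on V r"
proof -
  note inv = coord_sat_cap_fus_inv(1)[OF vs V_nonempty out]
  show "r \<in> R_CO V H" "sum r V = of_int \<lceil>max_rate\<rceil>"
    using inv_R_CO[OF inv] inv_total[OF inv] by auto
  show "integral_on V r" using coord_sat_cap_fus_integral[OF int vs out, of 1] by simp
qed

text \<open>An integral rate vector has an integral total, so the real lower bound rounds up; the
  algorithm run at the rounded value attains it.\<close>

lemma R_NCO_eq:
  assumes int: "\<And>X. X \<subseteq> V \<Longrightarrow> H X \<in> \<int>"
  shows "R_NCO V H = of_int \<lceil>max_rate\<rceil>"
proof -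
  obtain vs where vs: "linear_ordering V vs" using ex_linear_ordering by blast
  obtain r P where out: "coord_sat_cap_fus V H (of_int \<lceil>max_rate\<rceil>) vs = (r, P)" by fastforce
  note opt = coord_sat_cap_fus_integral_opt[OF int vs out]
  have ge: "of_int \<lceil>max_rate\<rceil> \<le> sum q V" if q: "q \<in> R_CO V H" "integral_on V q" for q
  proof -
    have "sum q V \<in> \<int>" using q(2) by (intro Ints_sum) (auto simp: integral_on_def)
    then obtain z where "sum q V = of_int z" by (auto elim: Ints_cases)
    then show ?thesis using R_CO_total_ge[OF q(1)] by (simp add: ceiling_le_iff)
  qed
  show ?thesis unfolding R_NCO_def
  proof (rule Least_equality)
    show "of_int \<lceil>max_rate\<rceil> \<in> (\<lambda>r. sum r V) ` {r \<in> R_CO V H. integral_on V r}"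
      using opt by (intro image_eqI[of _ _ r]) auto
    show "of_int \<lceil>max_rate\<rceil> \<le> s" if "s \<in> (\<lambda>r. sum r V) ` {r \<in> R_CO V H. integral_on V r}" for s
      using that ge by blast
  qed
qed

section \<open>Termination and correctness of the decomposition loop\<close>

lemma mda_init_witness: "\<exists>Q. partition_on V Q \<and> card Q > 1 \<and> mda_init V H = partition_rate V H Q"
proof -
  define m where "m = Max ((\<lambda>i. partition_rate V H {{i}, V - {i}}) ` V)"
  have "m \<in> (\<lambda>i. partition_rate V H {{i}, V - {i}}) ` V"
    unfolding m_def using finite_V V_nonempty by (intro Max_in) auto
  then obtain i where i: "i \<in> V" and m: "m = partition_rate V H {{i}, V - {i}}" by blast
  have "V - {i} \<noteq> {}"
  proof
    assume "V - {i} = {}"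
    then have "V = {i}" using i by auto
    then have "card V = 1" by simp
    then show False using card_V by simp
  qed
  then have "partition_on V {{i}, V - {i}}"
    using i by (auto simp: partition_on_def pairwise_insert disjnt_def)
  moreover have "{i} \<noteq> V - {i}" by auto
  then have "card {{i}, V - {i}} > 1" by simp
  moreover have "mda_init V H = m \<or> mda_init V H = partition_rate V H ((\<lambda>m. {m}) ` V)"
    unfolding mda_init_def m_def[symmetric] by (simp add: max_def)
  ultimately show ?thesis using m singletons_partition by metis
qed

text \<open>The upper bound makes the stopping test conclusive, since below the maximum the output
  has \<phi>(P) > \<alpha>. Recording the call lets the invariant of its output be
  recovered.\<close>

definition mda_inv :: "(nat \<Rightarrow> 'a list) \<Rightarrow> nat \<times> real \<times> ('a \<Rightarrow> real) \<times> 'a set set \<Rightarrow> bool" where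
  "mda_inv ords = (\<lambda>(k, \<alpha>, r, P). \<alpha> \<le> max_rate \<and> coord_sat_cap_fus V H \<alpha> (ords k) = (r, P))"

lemma mda_result:
  assumes ords: "\<And>k. linear_ordering V (ords k)"
  obtains k r P where "mda V H ords = Some (max_rate, P, r)"
    "coord_sat_cap_fus V H max_rate (ords k) = (r, P)"
proof -
  define b where "b = (\<lambda>(k::nat, \<alpha>, r::'a \<Rightarrow> real, P). partition_rate V H P \<noteq> \<alpha>)"
  define c where "c = (\<lambda>(k, \<alpha>::real, r::'a \<Rightarrow> real, P).
             let \<alpha>' = partition_rate V H P;
                 (r', P') = coord_sat_cap_fus V H \<alpha>' (ords (Suc k))
             in (Suc k, \<alpha>', r', P'))"
  define s0 where "s0 = (let \<alpha> = mda_init V H; (r, P) = coord_sat_cap_fus V H \<alpha> (ords 0) in (0 :: nat, \<alpha>, r, P))"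
  \<comment> \<open>Termination measure: the number of partitions with rate above \<alpha>. Each
    round removes the partition just found.\<close>
  define better where "better = (\<lambda>\<alpha>. {Q. (partition_on V Q \<and> card Q > 1) \<and> \<alpha> < partition_rate V H Q})"
  have init: "mda_inv ords s0"
    using mda_init_witness rate_le_max_rate
    by (auto simp: mda_inv_def s0_def Let_def split: prod.splits)
  have step: "mda_inv ords (c s) \<and> card (better (fst (snd (c s)))) < card (better (fst (snd s)))"
    if s: "mda_inv ords s" "b s" for s
  proof -
    obtain k \<alpha> r P where seq: "s = (k, \<alpha>, r, P)" by (cases s) auto
    have le: "\<alpha> \<le> max_rate" and out: "coord_sat_cap_fus V H \<alpha> (ords k) = (r, P)"
      and neq: "partition_rate V H P \<noteq> \<alpha>"
      using s by (auto simp: seq mda_inv_def b_def)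
    note inv = coord_sat_cap_fus_inv(1)[OF ords V_nonempty out]
    \<comment> \<open>At the maximum the output would attain \<alpha>, and the loop would have
      stopped.\<close>
    have "\<alpha> \<noteq> max_rate" using inv_fundamental(2)[OF inv] neq by auto
    then have lt: "\<alpha> < max_rate" using le by simp
    note imp = inv_improves[OF inv lt]
    have P: "partition_on V P" by (rule inv_partition[OF inv])
    have "mda_inv ords (c s)"
      using rate_le_max_rate[OF P imp(1)]
      by (auto simp: seq c_def mda_inv_def Let_def split: prod.splits)
    moreover have "better (partition_rate V H P) \<subset> better \<alpha>"
      using imp P by (auto simp: better_def)
    moreover have "finite (better \<alpha>)"
      using finite_partitions by (rule rev_finite_subset) (auto simp: better_def)
    moreover have "fst (snd (c s)) = partition_rate V H P"
      by (auto simp: seq c_def Let_def split: prod.splits)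
    ultimately show ?thesis by (simp add: seq psubset_card_mono)
  qed
  obtain t where t: "while_option b c s0 = Some t"
    using measure_while_option_Some[of "mda_inv ords" b c "\<lambda>s. card (better (fst (snd s)))"] step init
    by blast
  obtain k \<alpha> r P where teq: "t = (k, \<alpha>, r, P)" by (cases t) auto
  have "mda_inv ords t"
    using while_option_rule[of "mda_inv ords" b c s0 t] step t init by blast
  then have le: "\<alpha> \<le> max_rate" and out: "coord_sat_cap_fus V H \<alpha> (ords k) = (r, P)"
    by (auto simp: teq mda_inv_def)
  note inv = coord_sat_cap_fus_inv(1)[OF ords V_nonempty out]
  have "partition_rate V H P = \<alpha>" using while_option_stop[OF t] by (simp add: teq b_def)
  then have "\<alpha> = max_rate" using le inv_improves(2)[OF inv] by force
  moreover have "mda V H ords = Some (\<alpha>, P, r)"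
    using t by (simp add: mda_def b_def c_def s0_def teq)
  ultimately show ?thesis using that out by blast
qed

lemma mda_optimal:
  assumes int: "\<And>X. X \<subseteq> V \<Longrightarrow> H X \<in> \<int>" and ords: "\<And>k. linear_ordering V (ords k)"
  shows "\<exists>\<alpha> P r. mda V H ords = Some (\<alpha>, P, r) \<and> r \<in> R_ACO_opt V H \<and>
    integral_on V (\<lambda>i. (real (card (fundamental_partition V H)) - 1) * r i)"
proof -
  obtain k r P where mda: "mda V H ords = Some (max_rate, P, r)"
    and out: "coord_sat_cap_fus V H max_rate (ords k) = (r, P)"
    by (rule mda_result[OF ords])
  note inv = coord_sat_cap_fus_inv(1)[OF ords V_nonempty out]
  note fund = inv_fundamental[OF inv refl]
  have opt: "r \<in> R_ACO_opt V H"
    using inv_R_CO[OF inv] inv_total[OF inv] by (simp add: R_ACO_opt_def R_ACO_eq)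
  \<comment> \<open>The integrality lemma takes a natural factor; |P| > 1 makes the truncated
    subtraction exact.\<close>
  have eq: "real (card P - 1) = real (card P) - 1" using fund(1) by simp
  \<comment> \<open>Multiplying \<phi>(P) by |P| - 1 clears its only denominator.\<close>
  have "(\<Sum>C\<in>P. H V - H C) \<in> \<int>"
    using int inv_partition[OF inv] by (intro Ints_sum Ints_diff) (auto simp: partition_on_def)
  then have "real (card P - 1) * max_rate \<in> \<int>" using sum_rate[OF fund(1)] fund(2) eq by simp
  from coord_sat_cap_fus_integral[OF int ords out this]
  have "integral_on V (\<lambda>i. (real (card P) - 1) * r i)" unfolding eq .
  then show ?thesis using mda opt fund(3) by simp
qed

lemma coord_sat_cap_fus_optimal:
  assumes int: "\<And>X. X \<subseteq> V \<Longrightarrow> H X \<in> \<int>" and vs: "linear_ordering V vs"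
  shows "\<exists>r P. coord_sat_cap_fus V H (R_NCO V H) vs = (r, P) \<and> r \<in> R_NCO_opt V H \<and> integral_on V r"
proof -
  obtain r P where out: "coord_sat_cap_fus V H (of_int \<lceil>max_rate\<rceil>) vs = (r, P)" by fastforce
  from coord_sat_cap_fus_integral_opt[OF int vs out] out show ?thesis
    by (simp add: R_NCO_opt_def R_NCO_eq[OF int])
qed

end

section \<open>Instantiation with the entropy of a linear source\<close>

theorem corollaryV12:
  fixes V :: "'v set" and l :: nat and A :: "'v \<Rightarrow> 'q::{finite,field} mat"
    and H :: "'v set \<Rightarrow> real" and Pstar :: "'v set set"
  assumes "card V > 1"
    and "finite_linear_source V l A"
    and "H = source_entropy l A"
    and "Pstar = fundamental_partition V H"
  shows "(\<forall>ords. (\<forall>k. linear_ordering V (ords k)) \<longrightarrow>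
            (\<exists>\<alpha> P r. mda V H ords = Some (\<alpha>, P, r) \<and>
               r \<in> R_ACO_opt V H \<and>
               integral_on V (\<lambda>i. (real (card Pstar) - 1) * r i))) \<and>
         (\<forall>vs. linear_ordering V vs \<longrightarrow>
            (\<exists>r P. coord_sat_cap_fus V H (R_NCO V H) vs = (r, P) \<and>
               r \<in> R_NCO_opt V H \<and> integral_on V r))"
proof -
  have fin: "finite V" and dims: "\<And>i. i \<in> V \<Longrightarrow> dim_col (A i) = l"
    using assms(2) by (auto simp: finite_linear_source_def)
  interpret omniscience_problem V H
  proof
    show "H (X \<union> Y) + H (X \<inter> Y) \<le> H X + H Y" if "X \<subseteq> V" "Y \<subseteq> V" for X Y
      unfolding assms(3) using that dims by (intro source_entropy_submodular) blast
  qed (fact fin assms(1))+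
  have int: "H X \<in> \<int>" if "X \<subseteq> V" for X
    unfolding assms(3) using that dims fin by (intro source_entropy_Ints) (auto intro: finite_subset)
  show ?thesis unfolding assms(4)
  proof (intro conjI allI impI)
    show "\<exists>\<alpha> P r. mda V H ords = Some (\<alpha>, P, r) \<and> r \<in> R_ACO_opt V H \<and>
        integral_on V (\<lambda>i. (real (card (fundamental_partition V H)) - 1) * r i)"
      if "\<forall>k. linear_ordering V (ords k)" for ords
      by (rule mda_optimal) (simp_all add: int that)
    show "\<exists>r P. coord_sat_cap_fus V H (R_NCO V H) vs = (r, P) \<and> r \<in> R_NCO_opt V H \<and> integral_on V r"
      if "linear_ordering V vs" for vs
      by (rule coord_sat_cap_fus_optimal) (simp_all add: int that)
  qed
qed

end
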